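(* Let $\kappa \in \mathbb{R}$, and let $M$ be a complete metric space of curvature $\ge \kappa$ in the sense of Alexandrov. Suppose that every pair of points in $M$ at distance $< D_\kappa$ is connected by a segment. Then every hinge $H_p(x,y)$ in $M$ with $\operatorname{per}(p,x,y) < 2D_\kappa$ satisfies all three comparison properties (A$_\kappa$), (H$_\kappa$), and (D$_\kappa$).
   Context: Let $M$ be a metric space with metric $d$; write $|pq| := d(p,q)$. A segment connecting $p,q \in M$ is the image of an isometric embedding $[0,d(p,q)] \to M$ mapping $0$ to $p$ and $d(p,q)$ to $q$; $pq$ denotes some such segment (not necessarily unique). A hinge $H = H_p(x,y)$ in $M$ consists of three points $p,x,y$ and two nondegenerate segments $px, py$ in $M$ (so $p \notin \{x,y\}$, but possibly $x = y$); $p$ is its vertex, $x,y$ its endpoints, $px,py$ its sides. The perimeter is $\operatorname{per}(H) = \operatorname{per}(p,x,y) := |px|+|py|+|xy|$. $\mathbb{M}^2_\kappa$ is the complete, simply connected surface of constant curvature $\kappa$, and $D_\kappa$ is its diameter: $D_\kappa = \pi/\sqrt{\kappa}$ if $\kappa>0$, $D_\kappa = \infty$ if $\kappa \le 0$. In $\mathbb{M}^2_\kappa$, $\angle_{\bar p}(\bar x,\bar y)$ denotes the usual angle of a hinge. A comparison triple for $(p,x,y)$ is a triple $(\bar p,\bar x,\bar y)$ in $\mathbb{M}^2_\kappa$ with $|\bar p\bar x| = |px|$, $|\bar p\bar y| = |py|$, $|\bar x\bar y| = |xy|$ (it exists if $\kappa \le 0$, or if $\kappa>0$ and $\operatorname{per}(p,x,y)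 \le 2D_\kappa$). For $p \notin \{x,y\}$ (and, if $\kappa>0$, $|px|,|py| < D_\kappa$ and $\operatorname{per}(p,x,y) \le 2D_\kappa$), the comparison angle is $\angle^\kappa_p(x,y) := \angle_{\bar p}(\bar x,\bar y) \in [0,\pi]$. The (upper) angle of a hinge $H_p(x,y)$ in $M$ is $\angle_p(x,y) := \limsup \angle^\kappa_p(u,v)$ as $u \in px$, $v \in py$, $u,v \to p$ ($u,v\neq p$); it is independent of $\kappa$. For a hinge $H = H_p(x,y)$ in $M$ with $\operatorname{per}(H) < 2D_\kappa$, let $(\bar p,\bar x,\bar y)$ be a comparison triple in $\mathbb{M}^2_\kappa$ for $(p,x,y)$ and let $H_{\hat p}(\hat x,\hat y)$ be a comparison hinge in $\mathbb{M}^2_\kappa$, i.e. $|\hat p\hat x| = |px|$, $|\hat p\hat y| = |py|$, $\angle_{\hat p}(\hat x,\hat y) = \angle_p(x,y)$. The comparison properties are: (A$_\kappa$) $\angle_p(x,y) \ge \angle^\kappa_p(x,y)$; (H$_\kappa$) $|xy| \le |\hat x\hat y|$; (D$_\kappa$) $|uv| \ge |\bar u\bar v|$ whenever $u \in px$, $v \in py$, $\bar u \in \bar p\bar x$, $\bar v \in \bar p\bar y$ and $|pu| = |\bar p\bar u|$, $|pv| = |\bar p\bar v|$. $M$ is a space of curvature $\ge \kappa$ in the sense of Alexandrov if every point $q \in M$ has a neighborhood $U_q$ such that any two points in $U_q$ are connected by a segment in $M$ and every hinge $H_p(x,y)$ in $M$ with $p,x,y \in U_q$ and $\operatorname{per}(p,x,y)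 < 2D_\kappa$ satisfies (D$_\kappa$). *)

theory Defs
  imports "HOL-Analysis.Analysis"
begin

definition model_diam :: "real \<Rightarrow> ereal" where
  "model_diam \<kappa> = (if \<kappa> > 0 then ereal (pi / sqrt \<kappa>) else \<infinity>)"

text \<open>
  The model surface of constant curvature \<open>\<kappa>\<close> is realised inside \<open>real ^ 3\<close> for every \<open>\<kappa>\<close>:
  the unit sphere with its great-circle distance rescaled by \<open>1 / sqrt \<kappa>\<close> (\<open>\<kappa> > 0\<close>), the
  Euclidean plane \<open>x $ 3 = 0\<close> (\<open>\<kappa> = 0\<close>), and the upper sheet of the hyperboloid in Minkowski
  space with its distance rescaled by \<open>1 / sqrt (- \<kappa>)\<close> (\<open>\<kappa> < 0\<close>).  The rescaling does not
  affect angles.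
\<close>

definition model_form :: "real \<Rightarrow> real ^ 3 \<Rightarrow> real ^ 3 \<Rightarrow> real" where
  "model_form \<kappa> x y =
     (if \<kappa> < 0 then x $ 1 * y $ 1 + x $ 2 * y $ 2 - x $ 3 * y $ 3 else x \<bullet> y)"

definition model_space :: "real \<Rightarrow> (real ^ 3) set" where
  "model_space \<kappa> =
     (if \<kappa> > 0 then {x. model_form \<kappa> x x = 1}
      else if \<kappa> = 0 then {x. x $ 3 = 0}
      else {x. model_form \<kappa> x x = -1 \<and> x $ 3 > 0})"

definition model_dist :: "real \<Rightarrow> real ^ 3 \<Rightarrow> real ^ 3 \<Rightarrow> real" where
  "model_dist \<kappa> x y =
     (if \<kappa> > 0 then arccos (model_form \<kappa> x y) / sqrt \<kappa>
      else if \<kappa> = 0 then dist x y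
      else arcosh (- model_form \<kappa> x y) / sqrt (- \<kappa>))"

text \<open>
  For \<open>x \<noteq> p\<close> (and \<open>x \<noteq> - p\<close> if \<open>\<kappa> > 0\<close>) the following vector is a positive multiple of the
  initial velocity of the unique minimal geodesic from \<open>p\<close> to \<open>x\<close>: for \<open>\<kappa> \<noteq> 0\<close> it is the
  component of \<open>x\<close> that is tangent to the model surface at \<open>p\<close>.
\<close>

definition model_dir :: "real \<Rightarrow> real ^ 3 \<Rightarrow> real ^ 3 \<Rightarrow> real ^ 3" where
  "model_dir \<kappa> p x =
     (if \<kappa> > 0 then x - model_form \<kappa> x p *\<^sub>R p
      else if \<kappa> = 0 then x - p
      else x + model_form \<kappa> x p *\<^sub>R p)"

text \<open>
  The angle at \<open>p\<close>; \<open>model_form \<kappa>\<close> restricts to the Riemannian inner product (up to the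
  rescaling) on tangent spaces.
\<close>

definition model_angle :: "real \<Rightarrow> real ^ 3 \<Rightarrow> real ^ 3 \<Rightarrow> real ^ 3 \<Rightarrow> real" where
  "model_angle \<kappa> p x y =
     (let u = model_dir \<kappa> p x; v = model_dir \<kappa> p y
      in arccos (model_form \<kappa> u v / (sqrt (model_form \<kappa> u u) * sqrt (model_form \<kappa> v v))))"

text \<open>
  \<open>S\<close> is a segment from \<open>p\<close> to \<open>q\<close> in the metric space with carrier \<open>X\<close> and distance \<open>d\<close>.  The
  explicit carrier lets the same notion apply to a metric space type and to the model surfaces.
\<close>

definition segment_in :: "'a set \<Rightarrow> ('a \<Rightarrow> 'a \<Rightarrow> real) \<Rightarrow> 'a \<Rightarrow> 'a \<Rightarrow> 'a set \<Rightarrow> bool" where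
  "segment_in X d p q S \<longleftrightarrow>
     (\<exists>\<gamma>. \<gamma> ` {0..d p q} = S \<and> S \<subseteq> X \<and> \<gamma> 0 = p \<and> \<gamma> (d p q) = q \<and>
        (\<forall>s\<in>{0..d p q}. \<forall>t\<in>{0..d p q}. d (\<gamma> s) (\<gamma> t) = \<bar>s - t\<bar>))"

abbreviation segment :: "'a::metric_space \<Rightarrow> 'a \<Rightarrow> 'a set \<Rightarrow> bool" where
  "segment \<equiv> segment_in UNIV dist"

abbreviation model_segment :: "real \<Rightarrow> real ^ 3 \<Rightarrow> real ^ 3 \<Rightarrow> (real ^ 3) set \<Rightarrow> bool" where
  "model_segment \<kappa> \<equiv> segment_in (model_space \<kappa>) (model_dist \<kappa>)"

text \<open>A hinge carries its two sides \<open>S\<close> and \<open>T\<close>, since segments need not be unique.\<close>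

definition hinge :: "'a::metric_space \<Rightarrow> 'a \<Rightarrow> 'a \<Rightarrow> 'a set \<Rightarrow> 'a set \<Rightarrow> bool" where
  "hinge p x y S T \<longleftrightarrow> p \<noteq> x \<and> p \<noteq> y \<and> segment p x S \<and> segment p y T"

definition per :: "'a::metric_space \<Rightarrow> 'a \<Rightarrow> 'a \<Rightarrow> real" where
  "per p x y = dist p x + dist p y + dist x y"

definition comparison_triple ::
    "real \<Rightarrow> 'a::metric_space \<Rightarrow> 'a \<Rightarrow> 'a \<Rightarrow> real ^ 3 \<Rightarrow> real ^ 3 \<Rightarrow> real ^ 3 \<Rightarrow> bool" where
  "comparison_triple \<kappa> p x y p' x' y' \<longleftrightarrow>
     p' \<in> model_space \<kappa> \<and> x' \<in> model_space \<kappa> \<and> y' \<in> model_space \<kappa> \<and>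
     model_dist \<kappa> p' x' = dist p x \<and> model_dist \<kappa> p' y' = dist p y \<and>
     model_dist \<kappa> x' y' = dist x y"

text \<open>
  Meaningful only for \<open>p \<notin> {x, y}\<close> and, if \<open>\<kappa> > 0\<close>, for \<open>dist p x\<close> and \<open>dist p y\<close> smaller than
  \<open>model_diam \<kappa>\<close> and \<open>per p x y \<le> 2 * model_diam \<kappa>\<close>: a comparison triple then exists and all
  comparison triples have the same angle.
\<close>

definition comparison_angle :: "real \<Rightarrow> 'a::metric_space \<Rightarrow> 'a \<Rightarrow> 'a \<Rightarrow> real" where
  "comparison_angle \<kappa> p x y =
     (THE \<theta>. \<exists>p' x' y'. comparison_triple \<kappa> p x y p' x' y' \<and> \<theta> = model_angle \<kappa> p' x' y')"

text \<open>
  The upper angle at \<open>p\<close> of a hinge with sides \<open>S\<close> and \<open>T\<close>.  The filter \<open>at p within S\<close> excludes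
  \<open>p\<close> itself.  The upper limit is taken in \<open>ereal\<close>, a complete lattice; it lies in \<open>[0, pi]\<close>
  and is independent of \<open>\<kappa>\<close>.
\<close>

definition hinge_angle :: "real \<Rightarrow> 'a::metric_space \<Rightarrow> 'a set \<Rightarrow> 'a set \<Rightarrow> real" where
  "hinge_angle \<kappa> p S T =
     real_of_ereal (Limsup ((at p within S) \<times>\<^sub>F (at p within T))
       (\<lambda>(u, v). ereal (comparison_angle \<kappa> p u v)))"

definition comparison_hinge ::
    "real \<Rightarrow> 'a::metric_space \<Rightarrow> 'a \<Rightarrow> 'a \<Rightarrow> 'a set \<Rightarrow> 'a set \<Rightarrow>
     real ^ 3 \<Rightarrow> real ^ 3 \<Rightarrow> real ^ 3 \<Rightarrow> bool" where
  "comparison_hinge \<kappa> p x y S T p' x' y' \<longleftrightarrow>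
     p' \<in> model_space \<kappa> \<and> x' \<in> model_space \<kappa> \<and> y' \<in> model_space \<kappa> \<and>
     model_dist \<kappa> p' x' = dist p x \<and> model_dist \<kappa> p' y' = dist p y \<and>
     model_angle \<kappa> p' x' y' = hinge_angle \<kappa> p S T"

text \<open>
  The three comparison properties of a hinge with \<open>per p x y < 2 * model_diam \<kappa>\<close>.  Under this
  bound comparison triples and comparison hinges exist and are unique up to isometry of the model
  surface, so quantifying over all of them is the same as choosing one.
\<close>

definition angle_comparison ::
    "real \<Rightarrow> 'a::metric_space \<Rightarrow> 'a \<Rightarrow> 'a \<Rightarrow> 'a set \<Rightarrow> 'a set \<Rightarrow> bool" where
  "angle_comparison \<kappa> p x y S T \<longleftrightarrow> hinge_angle \<kappa> p S T \<ge> comparison_angle \<kappa> p x y"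

definition hinge_comparison ::
    "real \<Rightarrow> 'a::metric_space \<Rightarrow> 'a \<Rightarrow> 'a \<Rightarrow> 'a set \<Rightarrow> 'a set \<Rightarrow> bool" where
  "hinge_comparison \<kappa> p x y S T \<longleftrightarrow>
     (\<forall>p' x' y'. comparison_hinge \<kappa> p x y S T p' x' y' \<longrightarrow> dist x y \<le> model_dist \<kappa> x' y')"

definition distance_comparison ::
    "real \<Rightarrow> 'a::metric_space \<Rightarrow> 'a \<Rightarrow> 'a \<Rightarrow> 'a set \<Rightarrow> 'a set \<Rightarrow> bool" where
  "distance_comparison \<kappa> p x y S T \<longleftrightarrow>
     (\<forall>p' x' y' S' T'. comparison_triple \<kappa> p x y p' x' y' \<and>
        model_segment \<kappa> p' x' S' \<and> model_segment \<kappa> p' y' T' \<longrightarrow>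
        (\<forall>u\<in>S. \<forall>v\<in>T. \<forall>u'\<in>S'. \<forall>v'\<in>T'.
           dist p u = model_dist \<kappa> p' u' \<and> dist p v = model_dist \<kappa> p' v' \<longrightarrow>
           dist u v \<ge> model_dist \<kappa> u' v'))"

definition alexandrov_curvature_ge :: "'a::metric_space itself \<Rightarrow> real \<Rightarrow> bool" where
  "alexandrov_curvature_ge M \<kappa> \<longleftrightarrow>
     (\<forall>q::'a. \<exists>U. q \<in> interior U \<and>
        (\<forall>a\<in>U. \<forall>b\<in>U. \<exists>S. segment a b S) \<and>
        (\<forall>p\<in>U. \<forall>x\<in>U. \<forall>y\<in>U. \<forall>S T.
           hinge p x y S T \<and> ereal (per p x y) < 2 * model_diam \<kappa> \<longrightarrow>
           distance_comparison \<kappa> p x y S T))"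

end

theory Submission
  imports Defs
begin

text \<open>
  The argument is the one of Lang and Schroeder. Suppose that a hinge at \<open>x\<close> with endpoints \<open>p\<close>, \<open>q\<close>
  violates (H), and that no hinge whose sides have a sum smaller by the factor \<open>2 / 3\<close> does so nearby.
  Move \<open>x\<close> along the longer side, say towards \<open>q\<close>, to a point \<open>x'\<close>. The two hinges at \<open>x\<close> and \<open>x'\<close>
  in the triangle \<open>p x x'\<close> are short, hence satisfy the angle comparison; since adjacent angles at
  \<open>x'\<close> add up to at most \<open>\<pi>\<close>, the comparison side of the hinge at \<open>x'\<close> does not exceed that of the
  hinge at \<open>x\<close>, so the new hinge is again a violation, and the sum of its sides has dropped by a
  uniform amount. This cannot go on forever. Consequently every violation has another one nearby that
  is smaller by a definite factor; by completeness these converge to a point where the local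
  comparison fails, a contradiction. Finally (H) for all hinges yields (A) and, by Alexandrov's lemma
  applied on each side in turn, (D).
\<close>

section \<open>Generalised trigonometric functions\<close>

text \<open>The local curvature bound is used at only two places: for the sum of adjacent angles,
  whose bound by \<pi> fails in general metric spaces, and at the limit point of the violations.

  The drop in the sum of the sides is uniform because the endpoints stay fixed and the comparison
  side never grows: the gap to the true distance persists and keeps the hinge away from the straight
  one, the only case in which nothing would be gained.

  For \<open>\<kappa> > 0\<close> the sum \<open>r0\<close> of the sides is only known to be below
  twice the diameter, so a sum below \<open>2 / 3 * r0\<close> alone does not ensure the perimeter
  bound. Short hinges are therefore those with sum below an \<open>N\<close> that is at most
  \<open>2 / 3 * r0\<close> and at most the diameter; this also makes the required segments exist.
  In addition \<open>N\<close> must exceed \<open>r0 / 2\<close>: the shorter side is at most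
  \<open>r0 / 2\<close>, so the length of a step stays away from 0. Any factor strictly between
  \<open>1 / 2\<close> and \<open>1\<close> could replace \<open>2 / 3\<close>.\<close>

definition sn :: "real \<Rightarrow> real \<Rightarrow> real" where
  "sn \<kappa> r = (if \<kappa> > 0 then sin (sqrt \<kappa> * r) / sqrt \<kappa> else if \<kappa> = 0 then r
             else sinh (sqrt (- \<kappa>) * r) / sqrt (- \<kappa>))"

definition md :: "real \<Rightarrow> real \<Rightarrow> real" where
  "md \<kappa> r = (if \<kappa> > 0 then (1 - cos (sqrt \<kappa> * r)) / \<kappa> else if \<kappa> = 0 then r\<^sup>2 / 2
             else (1 - cosh (sqrt (- \<kappa>) * r)) / \<kappa>)"

text \<open>
  \<open>sn\<close> is the generalised sine and \<open>md\<close> its primitive vanishing at \<open>0\<close>. Written with \<open>md\<close>, the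
  law of cosines takes the same form \<open>md c = md (a - b) + sn a * sn b * (1 - cos \<theta>)\<close> for every \<open>\<kappa>\<close>,
  including \<open>\<kappa> = 0\<close>.
\<close>

lemma sn_0 [simp]: "sn \<kappa> 0 = 0" and md_0 [simp]: "md \<kappa> 0 = 0"
  by (auto simp: sn_def md_def)

lemma sn_minus: "sn \<kappa> (- a) = - sn \<kappa> a" and md_minus: "md \<kappa> (- a) = md \<kappa> a"
  by (auto simp: sn_def md_def)

lemma sn_add: "sn \<kappa> (a + b) = sn \<kappa> a * (1 - \<kappa> * md \<kappa> b) + (1 - \<kappa> * md \<kappa> a) * sn \<kappa> b"
  by (auto simp: sn_def md_def distrib_left sin_add sinh_add add_divide_distrib)

lemma md_add:
  "md \<kappa> (a + b) = md \<kappa> a + md \<kappa> b - \<kappa> * md \<kappa> a * md \<kappa> b + sn \<kappa> a * sn \<kappa> b"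
proof -
  consider "\<kappa> > 0" | "\<kappa> = 0" | "\<kappa> < 0" by linarith
  then show ?thesis
  proof cases
    case 1
    then have "sqrt \<kappa> * sqrt \<kappa> = \<kappa>" by simp
    then show ?thesis using 1
      by (simp add: sn_def md_def distrib_left cos_add divide_simps) (simp add: algebra_simps)
  next
    case 2
    then show ?thesis by (simp add: sn_def md_def power2_eq_square field_simps)
  next
    case 3
    then have "sqrt (-\<kappa>) * sqrt (-\<kappa>) = -\<kappa>" by simp
    then show ?thesis using 3
      by (simp add: sn_def md_def distrib_left cosh_add divide_simps) (simp add: algebra_simps)
  qed
qed

lemma sn_squared: "sn \<kappa> a * sn \<kappa> a = 2 * md \<kappa> a - \<kappa> * md \<kappa> a * md \<kappa> a"
  using md_add[of \<kappa> a "-a"] by (simp add: sn_minus md_minus)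

lemma md_diff:
  "md \<kappa> (a - b) = md \<kappa> a + md \<kappa> b - \<kappa> * md \<kappa> a * md \<kappa> b - sn \<kappa> a * sn \<kappa> b"
  using md_add[of \<kappa> a "-b"] by (simp add: sn_minus md_minus)

lemma md_add_minus_md_diff: "md \<kappa> (a + b) - md \<kappa> (a - b) = 2 * (sn \<kappa> a * sn \<kappa> b)"
  by (simp add: md_add md_diff)

lemma md_commute: "md \<kappa> (a - b) = md \<kappa> (b - a)"
  using md_minus[of \<kappa> "a - b"] by simp

lemma md_abs: "md \<kappa> \<bar>a\<bar> = md \<kappa> a"
  by (simp add: abs_if md_minus)

section \<open>Monotonicity up to the diameter\<close>

lemma less_model_diam_iff:
  "ereal a < model_diam \<kappa> \<longleftrightarrow> (\<kappa> > 0 \<longrightarrow> sqrt \<kappa> * a < pi)"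
  "ereal a \<le> model_diam \<kappa> \<longleftrightarrow> (\<kappa> > 0 \<longrightarrow> sqrt \<kappa> * a \<le> pi)"
  by (auto simp: model_diam_def field_simps)

lemma less_twice_model_diam_iff:
  "ereal c < 2 * model_diam \<kappa> \<longleftrightarrow> ereal (c / 2) < model_diam \<kappa>"
  by (cases "\<kappa> > 0") (simp_all add: model_diam_def field_simps)

lemma less_model_diam_mono: "ereal b < model_diam \<kappa> \<Longrightarrow> a \<le> b \<Longrightarrow> ereal a < model_diam \<kappa>"
  by (metis ereal_less_eq(3) order_le_less_trans)

lemma sn_pos:
  assumes "0 < a" "ereal a < model_diam \<kappa>"
  shows "0 < sn \<kappa> a"
  using assms by (auto simp: sn_def less_model_diam_iff intro!: divide_pos_pos sin_gt_zero)

lemma sn_nonneg: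
  assumes "0 \<le> a" "ereal a < model_diam \<kappa>"
  shows "0 \<le> sn \<kappa> a"
  using sn_pos[of a \<kappa>] assms by (cases "a = 0") auto

lemma md_strict_mono:
  assumes "0 \<le> a" "a < b" "ereal b \<le> model_diam \<kappa>"
  shows "md \<kappa> a < md \<kappa> b"
proof -
  consider "\<kappa> > 0" | "\<kappa> = 0" | "\<kappa> < 0" by linarith
  then show ?thesis
  proof cases
    case 1
    then have "cos (sqrt \<kappa> * b) < cos (sqrt \<kappa> * a)"
      using assms by (intro cos_monotone_0_pi) (auto simp: less_model_diam_iff)
    with 1 show ?thesis by (simp add: md_def divide_strict_right_mono)
  next
    case 2
    then show ?thesis using assms by (simp add: md_def power_strict_mono)
  next
    case 3
    then have "cosh (sqrt (-\<kappa>) * a) < cosh (sqrt (-\<kappa>) * b)"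
      using assms by (simp add: cosh_real_nonneg_less_iff)
    with 3 show ?thesis by (simp add: md_def divide_strict_right_mono_neg)
  qed
qed

lemma md_le_iff:
  assumes "0 \<le> a" "0 \<le> b" "ereal a \<le> model_diam \<kappa>" "ereal b \<le> model_diam \<kappa>"
  shows "md \<kappa> a \<le> md \<kappa> b \<longleftrightarrow> a \<le> b"
  using md_strict_mono[of a b \<kappa>] md_strict_mono[of b a \<kappa>] assms
  by (metis linorder_not_less order_le_less)

text \<open>
  For \<open>\<kappa> > 0\<close> this covers \<open>r\<close> beyond the diameter \<open>D\<close>, where \<open>md r = md (2 * D - r)\<close>.
\<close>

lemma md_mono_fold:
  assumes "0 \<le> c" "c \<le> r" "ereal ((r + c) / 2) \<le> model_diam \<kappa>"
  shows "md \<kappa> c \<le> md \<kappa> r"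
proof -
  \<comment> \<open>By the sum-to-product formula below, the sign of this product is the sign of
    \<open>md \<kappa> r - md \<kappa> c\<close>.\<close>
  have "0 \<le> sn \<kappa> ((r - c) / 2) * sn \<kappa> ((r + c) / 2)"
  proof (cases "\<kappa> > 0")
    case True
    have *: "sqrt \<kappa> * ((r + c) / 2) \<le> pi" using assms(3) True by (simp add: less_model_diam_iff)
    have "sqrt \<kappa> * ((r - c) / 2) \<le> sqrt \<kappa> * ((r + c) / 2)"
      using True assms by (intro mult_left_mono) auto
    then have "sqrt \<kappa> * ((r - c) / 2) \<le> pi" using * by linarith
    then have "0 \<le> sin (sqrt \<kappa> * ((r - c) / 2))" "0 \<le> sin (sqrt \<kappa> * ((r + c) / 2))"
      using * True assms by (auto intro!: sin_ge_zero mult_nonneg_nonneg)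
    then show ?thesis using True by (simp add: sn_def)
  next
    case False
    then show ?thesis using assms by (auto intro!: mult_nonneg_nonneg sn_nonneg simp: model_diam_def)
  qed
  moreover have "md \<kappa> r - md \<kappa> c = 2 * (sn \<kappa> ((r + c) / 2) * sn \<kappa> ((r - c) / 2))"
    using md_add_minus_md_diff[of \<kappa> "(r + c) / 2" "(r - c) / 2"] by (simp add: field_simps)
  ultimately show ?thesis by (simp add: mult.commute)
qed

lemma md_has_derivative: "(md \<kappa> has_real_derivative sn \<kappa> r) (at r)"
proof -
  consider "\<kappa> > 0" | "\<kappa> = 0" | "\<kappa> < 0" by linarith
  then show ?thesis
  proof cases
    case 1
    then have "md \<kappa> = (\<lambda>r. (1 - cos (sqrt \<kappa> * r)) / \<kappa>)" by (auto simp: md_def)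
    moreover have "((\<lambda>r. (1 - cos (sqrt \<kappa> * r)) / \<kappa>) has_real_derivative sn \<kappa> r) (at r)"
      using 1 by (auto intro!: derivative_eq_intros simp: sn_def field_simps)
    ultimately show ?thesis by simp
  next
    case 2
    then have "md \<kappa> = (\<lambda>r. r\<^sup>2 / 2)" by (auto simp: md_def)
    then show ?thesis using 2 by (auto intro!: derivative_eq_intros simp: sn_def)
  next
    case 3
    then have "md \<kappa> = (\<lambda>r. (1 - cosh (sqrt (-\<kappa>) * r)) / \<kappa>)" by (auto simp: md_def)
    moreover have "((\<lambda>r. (1 - cosh (sqrt (-\<kappa>) * r)) / \<kappa>) has_real_derivative sn \<kappa> r) (at r)"
    proof -
      define q where "q = sqrt (- \<kappa>)"
      have q: "q > 0" "\<kappa> = - (q * q)" using 3 by (auto simp: q_def)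
      have "((\<lambda>r. (1 - cosh (q * r)) / \<kappa>) has_real_derivative (0 - sinh (q * r) * q) / \<kappa>) (at r)"
        using 3 by (auto intro!: derivative_eq_intros)
      also have "(0 - sinh (q * r) * q) / \<kappa> = sn \<kappa> r"
        using 3 q(1) unfolding sn_def q_def[symmetric] by (simp add: q(2))
      finally show ?thesis by (simp add: q_def)
    qed
    ultimately show ?thesis by simp
  qed
qed

lemma continuous_on_sn: "continuous_on A (sn \<kappa>)"
proof -
  consider "\<kappa> > 0" | "\<kappa> = 0" | "\<kappa> < 0" by linarith
  then show ?thesis
    by cases (auto simp: sn_def[abs_def] intro!: continuous_intros)
qed

lemma md_lipschitz:
  obtains L where "0 < L" "\<And>a b. 0 \<le> a \<Longrightarrow> a \<le> b \<Longrightarrow> b \<le> R \<Longrightarrow> md \<kappa> b - md \<kappa> a \<le> L * (b - a)"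
    "\<And>a. 0 \<le> a \<Longrightarrow> a \<le> R \<Longrightarrow> sn \<kappa> a \<le> L"
proof -
  have "compact (sn \<kappa> ` {0..R})"
    by (intro compact_continuous_image continuous_on_sn) auto
  then obtain L where L: "L > 0" "\<And>x. x \<in> {0..R} \<Longrightarrow> \<bar>sn \<kappa> x\<bar> \<le> L"
    by (metis bounded_pos compact_imp_bounded imageI real_norm_def)
  have "md \<kappa> b - md \<kappa> a \<le> L * (b - a)" if ab: "0 \<le> a" "a \<le> b" "b \<le> R" for a b
  proof (cases "a = b")
    case False
    then obtain z where z: "a < z" "z < b" "md \<kappa> b - md \<kappa> a = (b - a) * sn \<kappa> z"
      using MVT2[of a b "md \<kappa>" "sn \<kappa>"] md_has_derivative ab by (metis order_le_less)
    have "sn \<kappa> z \<le> L" using L(2)[of z] z ab by auto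
    then have "(b - a) * sn \<kappa> z \<le> (b - a) * L" using ab by (intro mult_left_mono) auto
    with z show ?thesis by (simp add: mult.commute)
  qed auto
  moreover have "sn \<kappa> a \<le> L" if "0 \<le> a" "a \<le> R" for a using L(2)[of a] that by auto
  ultimately show ?thesis by (rule that[OF L(1)])
qed

text \<open>
  \<open>cosang \<kappa> a b c\<close> is the cosine of the angle opposite to \<open>c\<close>, and \<open>mdside \<kappa> a b (cos \<theta>)\<close> is \<open>md\<close> of
  the side opposite to \<open>\<theta>\<close>. For \<open>\<kappa> > 0\<close> the function \<open>md\<close> is injective only up to the diameter.
\<close>

definition cosang :: "real \<Rightarrow> real \<Rightarrow> real \<Rightarrow> real \<Rightarrow> real" where
  "cosang \<kappa> a b c = 1 - (md \<kappa> c - md \<kappa> (a - b)) / (sn \<kappa> a * sn \<kappa> b)"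

lemma cosang_commute: "cosang \<kappa> a b c = cosang \<kappa> b a c"
  by (simp add: cosang_def mult.commute md_commute[of \<kappa> a b])

definition mdside :: "real \<Rightarrow> real \<Rightarrow> real \<Rightarrow> real \<Rightarrow> real" where
  "mdside \<kappa> a b t = md \<kappa> (a - b) + sn \<kappa> a * sn \<kappa> b * (1 - t)"

lemma mdside_commute: "mdside \<kappa> a b t = mdside \<kappa> b a t"
  by (simp add: mdside_def mult.commute md_commute[of \<kappa> a b])

lemma mdside_cosang:
  assumes "sn \<kappa> a > 0" "sn \<kappa> b > 0"
  shows "mdside \<kappa> a b (cosang \<kappa> a b c) = md \<kappa> c"
  using assms by (simp add: cosang_def mdside_def)

lemma mdside_le_iff:
  assumes "sn \<kappa> a > 0" "sn \<kappa> b > 0"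
  shows "mdside \<kappa> a b t \<le> mdside \<kappa> a b t' \<longleftrightarrow> t' \<le> t"
  using assms by (auto simp: mdside_def)

lemma md_le_mdside_iff:
  assumes "sn \<kappa> a > 0" "sn \<kappa> b > 0"
  shows "md \<kappa> c \<le> mdside \<kappa> a b t \<longleftrightarrow> t \<le> cosang \<kappa> a b c"
  using mdside_le_iff[OF assms, of "cosang \<kappa> a b c" t] mdside_cosang[OF assms] by simp

lemma mdside_le_md_iff:
  assumes "sn \<kappa> a > 0" "sn \<kappa> b > 0"
  shows "mdside \<kappa> a b t \<le> md \<kappa> c \<longleftrightarrow> cosang \<kappa> a b c \<le> t"
  using mdside_le_iff[OF assms, of t "cosang \<kappa> a b c"] mdside_cosang[OF assms] by simp

text \<open>For the cosines \<open>1\<close> and \<open>- 1\<close> the model triangle degenerates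
  to a third side \<open>\<bar>a - b\<bar>\<close> or \<open>a + b\<close>, so the bounds are the
  triangle inequalities seen through \<open>md\<close>. As \<open>a + b\<close> may exceed the
  diameter, monotonicity comes from \<open>md_mono_fold\<close>.\<close>

lemma cosang_bounds:
  assumes "0 < a" "0 < b" "\<bar>a - b\<bar> \<le> c" "c \<le> a + b" "ereal ((a + b + c) / 2) < model_diam \<kappa>"
  shows "cosang \<kappa> a b c \<in> {-1..1}"
proof -
  have ab: "ereal a < model_diam \<kappa>" "ereal b < model_diam \<kappa>"
    and c: "ereal ((c + \<bar>a - b\<bar>) / 2) < model_diam \<kappa>"
    using assms by (auto elim!: less_model_diam_mono)
  have s: "sn \<kappa> a > 0" "sn \<kappa> b > 0" using ab assms sn_pos by auto
  have "md \<kappa> \<bar>a - b\<bar> \<le> md \<kappa> c" using assms c by (intro md_mono_fold) auto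
  then have 1: "mdside \<kappa> a b 1 \<le> md \<kappa> c" by (simp add: mdside_def md_abs)
  have "md \<kappa> c \<le> md \<kappa> (a + b)" using assms by (intro md_mono_fold) auto
  then have 2: "md \<kappa> c \<le> mdside \<kappa> a b (-1)"
    using md_add_minus_md_diff[of \<kappa> a b] by (simp add: mdside_def)
  show ?thesis using 1 2 s by (simp add: mdside_le_md_iff md_le_mdside_iff)
qed

text \<open>
  Two forms of Stewart's relation for a point \<open>V\<close> at distance \<open>s\<close> from \<open>A\<close> and \<open>t\<close> from \<open>B\<close> on a
  geodesic \<open>AB\<close> and a third point \<open>U\<close>: with angles at \<open>V\<close> (where \<open>h\<close> is the length of \<open>UV\<close>, and
  \<open>X + Y = 0\<close> in the model), and with the angle at \<open>A\<close> (where \<open>a\<close> is the length of \<open>UA\<close>).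
\<close>

lemma stewart_at_foot:
  "sn \<kappa> t * mdside \<kappa> s h X + sn \<kappa> s * mdside \<kappa> t h Y =
   sn \<kappa> (s + t) * md \<kappa> h + sn \<kappa> s * md \<kappa> t + sn \<kappa> t * md \<kappa> s - sn \<kappa> s * sn \<kappa> t * sn \<kappa> h * (X + Y)"
  unfolding mdside_def md_diff sn_add by (simp add: algebra_simps)

text \<open>The case \<open>a = 0\<close> of \<open>stewart_at_end\<close>, and the ingredient of
  its proof in which the Pythagorean identity \<open>sn_squared\<close> enters.\<close>

lemma sn_times_md_add:
  "sn \<kappa> s * md \<kappa> (s + t) = sn \<kappa> (s + t) * md \<kappa> s + sn \<kappa> s * md \<kappa> t + sn \<kappa> t * md \<kappa> s"
proof -
  have "sn \<kappa> s * md \<kappa> (s + t) =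
    sn \<kappa> s * (md \<kappa> s + md \<kappa> t - \<kappa> * md \<kappa> s * md \<kappa> t) + (sn \<kappa> s * sn \<kappa> s) * sn \<kappa> t"
    unfolding md_add by (simp add: algebra_simps)
  then show ?thesis
    unfolding sn_squared sn_add by (simp add: algebra_simps)
qed

lemma stewart_at_end:
  "sn \<kappa> t * md \<kappa> a + sn \<kappa> s * mdside \<kappa> (s + t) a Y =
   sn \<kappa> (s + t) * mdside \<kappa> s a Y + sn \<kappa> s * md \<kappa> t + sn \<kappa> t * md \<kappa> s"
proof -
  have "sn \<kappa> s * mdside \<kappa> (s + t) a Y =
    (sn \<kappa> s * md \<kappa> (s + t)) * (1 - \<kappa> * md \<kappa> a) + sn \<kappa> s * md \<kappa> a
    - sn \<kappa> s * sn \<kappa> (s + t) * sn \<kappa> a * Y"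
    unfolding mdside_def md_diff by (simp add: algebra_simps)
  also have "\<dots> = sn \<kappa> (s + t) * mdside \<kappa> s a Y + sn \<kappa> s * md \<kappa> t + sn \<kappa> t * md \<kappa> s - sn \<kappa> t * md \<kappa> a"
    unfolding sn_times_md_add mdside_def md_diff sn_add by (simp add: algebra_simps)
  finally show ?thesis by simp
qed

section \<open>The model surfaces\<close>

lemma model_form_commute: "model_form \<kappa> x y = model_form \<kappa> y x"
  by (simp add: model_form_def inner_commute mult.commute)

lemma model_form_add_left: "model_form \<kappa> (x + y) z = model_form \<kappa> x z + model_form \<kappa> y z"
  and model_form_diff_left: "model_form \<kappa> (x - y) z = model_form \<kappa> x z - model_form \<kappa> y z"
  and model_form_scale_left: "model_form \<kappa> (c *\<^sub>R x) z = c * model_form \<kappa> x z"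
  by (simp_all add: model_form_def inner_simps algebra_simps)

lemma model_form_add_right: "model_form \<kappa> z (x + y) = model_form \<kappa> z x + model_form \<kappa> z y"
  and model_form_diff_right: "model_form \<kappa> z (x - y) = model_form \<kappa> z x - model_form \<kappa> z y"
  and model_form_scale_right: "model_form \<kappa> z (c *\<^sub>R x) = c * model_form \<kappa> z x"
  by (simp_all add: model_form_commute[of \<kappa> z] model_form_add_left model_form_diff_left
      model_form_scale_left)

lemmas model_form_linear = model_form_add_left model_form_diff_left model_form_scale_left
  model_form_add_right model_form_diff_right model_form_scale_right

section \<open>Tangent planes of the model and positivity of the form\<close>

definition tangent :: "real \<Rightarrow> real ^ 3 \<Rightarrow> real ^ 3 \<Rightarrow> bool" where
  "tangent \<kappa> p u \<longleftrightarrow> (\<kappa> \<noteq> 0 \<longrightarrow> model_form \<kappa> u p = 0)"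

lemma tangent_linear: "tangent \<kappa> p u \<Longrightarrow> tangent \<kappa> p v \<Longrightarrow> tangent \<kappa> p (a *\<^sub>R u - b *\<^sub>R v)"
  by (simp add: tangent_def model_form_linear)

text \<open>For \<open>\<kappa> < 0\<close> the form is indefinite on the ambient space, but
  \<open>p\<close> is timelike, so its orthogonal complement is spacelike. Concretely this is
  Cauchy-Schwarz in the first two coordinates.\<close>

lemma model_form_tangent:
  assumes p: "p \<in> model_space \<kappa>" and u: "tangent \<kappa> p u"
  shows model_form_tangent_nonneg: "0 \<le> model_form \<kappa> u u"
    and model_form_tangent_eq_0: "model_form \<kappa> u u = 0 \<Longrightarrow> u = 0"
proof -
  have "0 \<le> model_form \<kappa> u u \<and> (model_form \<kappa> u u = 0 \<longrightarrow> u = 0)"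
  proof (cases "\<kappa> < 0")
    case True
    let ?n = "(u$1)\<^sup>2 + (u$2)\<^sup>2"
    have p3: "p$3 > 0" "(p$3)\<^sup>2 = 1 + (p$1)\<^sup>2 + (p$2)\<^sup>2" "u$3 * p$3 = u$1 * p$1 + u$2 * p$2"
      using p u True by (auto simp: model_space_def tangent_def model_form_def power2_eq_square)
    have "?n * ((p$1)\<^sup>2 + (p$2)\<^sup>2) - (u$1 * p$1 + u$2 * p$2)\<^sup>2 = (u$1 * p$2 - u$2 * p$1)\<^sup>2"
      by (simp add: power2_eq_square algebra_simps)
    then have "(u$1 * p$1 + u$2 * p$2)\<^sup>2 \<le> ?n * ((p$1)\<^sup>2 + (p$2)\<^sup>2)"
      using zero_le_power2[of "u$1 * p$2 - u$2 * p$1"] by linarith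
    then have "(u$3 * p$3)\<^sup>2 \<le> ?n * ((p$3)\<^sup>2 - 1)"
      using p3(2,3) by simp
    then have *: "?n \<le> (p$3)\<^sup>2 * model_form \<kappa> u u"
      using True by (simp add: model_form_def power2_eq_square algebra_simps)
    then have "0 \<le> (p$3)\<^sup>2 * model_form \<kappa> u u"
      by (smt (verit) sum_power2_ge_zero)
    then have "0 \<le> model_form \<kappa> u u"
      using p3(1) by (simp add: zero_le_mult_iff)
    moreover have "u = 0" if "model_form \<kappa> u u = 0"
    proof -
      have "u$1 = 0" "u$2 = 0" using * that by (simp_all add: sum_power2_le_zero_iff)
      then show ?thesis using p3 by (simp add: vec_eq_iff forall_3)
    qed
    ultimately show ?thesis by blast
  qed (auto simp: model_form_def)
  then show "0 \<le> model_form \<kappa> u u" "model_form \<kappa> u u = 0 \<Longrightarrow> u = 0" by auto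
qed

lemma model_form_cauchy_schwarz:
  assumes p: "p \<in> model_space \<kappa>" and u: "tangent \<kappa> p u" and v: "tangent \<kappa> p v"
  shows "(model_form \<kappa> u v)\<^sup>2 \<le> model_form \<kappa> u u * model_form \<kappa> v v"
proof (cases "model_form \<kappa> v v = 0")
  case True
  then have "v = 0" using model_form_tangent_eq_0[OF p v] by simp
  then show ?thesis by (simp add: model_form_def)
next
  case False
  then have v': "model_form \<kappa> v v > 0" using model_form_tangent_nonneg[OF p v] by simp
  let ?w = "model_form \<kappa> v v *\<^sub>R u - model_form \<kappa> u v *\<^sub>R v"
  have "0 \<le> model_form \<kappa> ?w ?w"
    by (rule model_form_tangent_nonneg[OF p tangent_linear[OF u v]])
  also have "\<dots> = model_form \<kappa> v v * (model_form \<kappa> u u * model_form \<kappa> v v - (model_form \<kappa> u v)\<^sup>2)"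
    by (simp add: model_form_linear model_form_commute[of \<kappa> v u] power2_eq_square algebra_simps)
  finally show ?thesis using v' by (simp add: zero_le_mult_iff)
qed

lemma tangent_model_dir:
  assumes "p \<in> model_space \<kappa>"
  shows "tangent \<kappa> p (model_dir \<kappa> p x)"
  using assms by (auto simp: tangent_def model_dir_def model_form_linear model_space_def)

text \<open>The reversed Cauchy-Schwarz inequality, which puts the argument of \<open>arcosh\<close>
  into the range where \<open>cosh\<close> is its inverse. The component of \<open>x\<close> tangent
  at \<open>y\<close> has square \<open>(model_form \<kappa> x y)\<^sup>2 - 1\<close>, so the
  modulus is at least 1; the sign is that of the upper sheet.\<close>

lemma model_form_ge_one:
  assumes "x \<in> model_space \<kappa>" "y \<in> model_space \<kappa>" "\<kappa> < 0"
  shows "1 \<le> - model_form \<kappa> x y"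
proof -
  let ?f = "model_form \<kappa>"
  have xx: "?f x x = -1" "?f y y = -1" "x$3 > 0" "y$3 > 0"
    using assms by (auto simp: model_space_def)
  have "0 \<le> ?f (model_dir \<kappa> y x) (model_dir \<kappa> y x)"
    by (rule model_form_tangent_nonneg[OF assms(2) tangent_model_dir[OF assms(2)]])
  also have "\<dots> = (?f x y)\<^sup>2 - 1"
    using assms(3) xx by (simp add: model_dir_def model_form_linear model_form_commute[of \<kappa> y x] power2_eq_square)
  finally have sq: "1 \<le> (?f x y)\<^sup>2" by simp
  have "(x$1 * y$1 + x$2 * y$2)\<^sup>2 \<le> ((x$1)\<^sup>2 + (x$2)\<^sup>2) * ((y$1)\<^sup>2 + (y$2)\<^sup>2)"
    using zero_le_power2[of "x$1 * y$2 - x$2 * y$1"]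
    by (simp add: power2_eq_square algebra_simps)
  also have "\<dots> \<le> (x$3)\<^sup>2 * (y$3)\<^sup>2"
    using xx assms(3) by (intro mult_mono) (auto simp: model_form_def power2_eq_square)
  finally have "(x$1 * y$1 + x$2 * y$2)\<^sup>2 \<le> (x$3 * y$3)\<^sup>2" by (simp add: power_mult_distrib)
  then have "x$1 * y$1 + x$2 * y$2 \<le> x$3 * y$3"
    by (rule power2_le_imp_le) (use xx in simp)
  then have "0 \<le> - ?f x y" using assms(3) by (simp add: model_form_def)
  with sq show ?thesis by (metis one_power2 power2_le_imp_le power2_minus)
qed

section \<open>Distances, angles and the law of cosines in the model\<close>

lemma model_dist_props:
  assumes x: "x \<in> model_space \<kappa>" and y: "y \<in> model_space \<kappa>"
  shows model_dist_nonneg: "0 \<le> model_dist \<kappa> x y"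
    and model_dist_le_diam: "ereal (model_dist \<kappa> x y) \<le> model_diam \<kappa>"
    and md_model_dist: "md \<kappa> (model_dist \<kappa> x y) =
      (if \<kappa> > 0 then (1 - model_form \<kappa> x y) / \<kappa> else if \<kappa> = 0 then (x - y) \<bullet> (x - y) / 2
       else (1 + model_form \<kappa> x y) / \<kappa>)"
proof -
  consider "\<kappa> > 0" | "\<kappa> = 0" | "\<kappa> < 0" by linarith
  then have "0 \<le> model_dist \<kappa> x y \<and> ereal (model_dist \<kappa> x y) \<le> model_diam \<kappa> \<and>
    md \<kappa> (model_dist \<kappa> x y) =
      (if \<kappa> > 0 then (1 - model_form \<kappa> x y) / \<kappa> else if \<kappa> = 0 then (x - y) \<bullet> (x - y) / 2
       else (1 + model_form \<kappa> x y) / \<kappa>)"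
  proof cases
    case 1
    have "x \<bullet> x = 1" "y \<bullet> y = 1"
      using assms 1 by (auto simp: model_space_def model_form_def)
    then have "\<bar>x \<bullet> y\<bar> \<le> 1"
      using Cauchy_Schwarz_ineq2[of x y] by (simp add: norm_eq_sqrt_inner)
    then have "-1 \<le> x \<bullet> y" "x \<bullet> y \<le> 1" by auto
    then have "0 \<le> arccos (x \<bullet> y)" "arccos (x \<bullet> y) \<le> pi" "cos (arccos (x \<bullet> y)) = x \<bullet> y"
      by (auto intro: arccos_lbound arccos_ubound)
    then show ?thesis
      using 1 by (auto simp: model_dist_def model_form_def md_def less_model_diam_iff)
  next
    case 2
    then show ?thesis
      by (simp add: model_dist_def md_def model_diam_def dist_norm dot_square_norm)
  next
    case 3
    then show ?thesis using model_form_ge_one[OF x y 3]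
      by (simp add: model_dist_def md_def model_diam_def cosh_arcosh_real)
  qed
  then show "0 \<le> model_dist \<kappa> x y" "ereal (model_dist \<kappa> x y) \<le> model_diam \<kappa>"
    "md \<kappa> (model_dist \<kappa> x y) =
      (if \<kappa> > 0 then (1 - model_form \<kappa> x y) / \<kappa> else if \<kappa> = 0 then (x - y) \<bullet> (x - y) / 2
       else (1 + model_form \<kappa> x y) / \<kappa>)"
    by auto
qed

lemma model_dist_eqI:
  assumes "x \<in> model_space \<kappa>" "y \<in> model_space \<kappa>" "0 \<le> c" "ereal c \<le> model_diam \<kappa>"
    and "md \<kappa> (model_dist \<kappa> x y) = md \<kappa> c"
  shows "model_dist \<kappa> x y = c"
  using md_le_iff[of c "model_dist \<kappa> x y" \<kappa>] md_le_iff[of "model_dist \<kappa> x y" c \<kappa>] assms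
    model_dist_nonneg[of x \<kappa> y] model_dist_le_diam[of x \<kappa> y] by auto

lemma model_dist_commute: "model_dist \<kappa> x y = model_dist \<kappa> y x"
  by (simp add: model_dist_def model_form_commute dist_commute)

lemma model_dist_self: "x \<in> model_space \<kappa> \<Longrightarrow> model_dist \<kappa> x x = 0"
  by (auto simp: model_dist_def model_space_def arcosh_1)

text \<open>
  The directions of \<open>model_dir\<close> have length \<open>sqrt (form_scale \<kappa>) * sn \<kappa> a\<close> because distances were
  rescaled but the ambient form was not.
\<close>

definition form_scale :: "real \<Rightarrow> real" where
  "form_scale \<kappa> = (if \<kappa> = 0 then 1 else \<bar>\<kappa>\<bar>)"

lemma form_scale_pos: "form_scale \<kappa> > 0"
  by (simp add: form_scale_def)

text \<open>The spherical, Euclidean and hyperbolic laws of cosines in one formula. Without division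
  by \<open>sn\<close> it also covers sides of length 0.\<close>

lemma model_form_model_dir:
  assumes "p \<in> model_space \<kappa>" "x \<in> model_space \<kappa>" "y \<in> model_space \<kappa>"
  defines "a \<equiv> model_dist \<kappa> p x" and "b \<equiv> model_dist \<kappa> p y" and "c \<equiv> model_dist \<kappa> x y"
  shows "model_form \<kappa> (model_dir \<kappa> p x) (model_dir \<kappa> p y) =
    form_scale \<kappa> * (md \<kappa> a + md \<kappa> b - \<kappa> * md \<kappa> a * md \<kappa> b - md \<kappa> c)"
proof -
  note m = md_model_dist[OF assms(1,2)] md_model_dist[OF assms(1,3)] md_model_dist[OF assms(2,3)]
  have f: "\<kappa> > 0 \<Longrightarrow> model_form \<kappa> p p = 1" "\<kappa> < 0 \<Longrightarrow> model_form \<kappa> p p = -1"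
    using assms(1) by (auto simp: model_space_def)
  consider "\<kappa> > 0" | "\<kappa> = 0" | "\<kappa> < 0" by linarith
  then show ?thesis
  proof cases
    case 1
    then show ?thesis unfolding a_def b_def c_def m
      by (simp add: form_scale_def model_dir_def model_form_linear f
          model_form_commute[of \<kappa> p x] model_form_commute[of \<kappa> p y] divide_simps) (simp add: algebra_simps)
  next
    case 2
    then show ?thesis unfolding a_def b_def c_def m
      by (simp add: form_scale_def model_dir_def model_form_def inner_simps inner_commute field_simps)
  next
    case 3
    then show ?thesis unfolding a_def b_def c_def m
      by (simp add: form_scale_def model_dir_def model_form_linear f
          model_form_commute[of \<kappa> p x] model_form_commute[of \<kappa> p y] divide_simps) (simp add: algebra_simps)
  qed
qed

lemma model_form_model_dir_cosang:
  assumes "p \<in> model_space \<kappa>" "x \<in> model_space \<kappa>" "y \<in> model_space \<kappa>"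
    and "sn \<kappa> (model_dist \<kappa> p x) > 0" "sn \<kappa> (model_dist \<kappa> p y) > 0"
  shows "model_form \<kappa> (model_dir \<kappa> p x) (model_dir \<kappa> p y) =
    form_scale \<kappa> * (sn \<kappa> (model_dist \<kappa> p x) * sn \<kappa> (model_dist \<kappa> p y) *
      cosang \<kappa> (model_dist \<kappa> p x) (model_dist \<kappa> p y) (model_dist \<kappa> x y))"
proof -
  have "md \<kappa> a + md \<kappa> b - \<kappa> * md \<kappa> a * md \<kappa> b - md \<kappa> c = sn \<kappa> a * sn \<kappa> b * cosang \<kappa> a b c"
    if "sn \<kappa> a > 0" "sn \<kappa> b > 0" for a b c
    using that by (simp add: cosang_def md_diff field_simps)
  then show ?thesis using assms by (simp add: model_form_model_dir)
qed

lemma model_form_model_dir_self: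
  assumes "p \<in> model_space \<kappa>" "x \<in> model_space \<kappa>"
  shows "model_form \<kappa> (model_dir \<kappa> p x) (model_dir \<kappa> p x) =
    form_scale \<kappa> * (sn \<kappa> (model_dist \<kappa> p x))\<^sup>2"
  using model_form_model_dir[OF assms(1,2,2)] sn_squared[of \<kappa> "model_dist \<kappa> p x"]
  by (simp add: model_dist_self assms power2_eq_square)

lemma model_angle_eq:
  assumes "p \<in> model_space \<kappa>" "x \<in> model_space \<kappa>" "y \<in> model_space \<kappa>"
    and sx: "sn \<kappa> (model_dist \<kappa> p x) > 0" and sy: "sn \<kappa> (model_dist \<kappa> p y) > 0"
  defines "C \<equiv> cosang \<kappa> (model_dist \<kappa> p x) (model_dist \<kappa> p y) (model_dist \<kappa> x y)"
  shows "model_angle \<kappa> p x y = arccos C" and "cos (model_angle \<kappa> p x y) = C"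
    and "0 \<le> model_angle \<kappa> p x y" and "model_angle \<kappa> p x y \<le> pi"
proof -
  let ?a = "sn \<kappa> (model_dist \<kappa> p x)" and ?b = "sn \<kappa> (model_dist \<kappa> p y)"
  let ?u = "model_dir \<kappa> p x" and ?v = "model_dir \<kappa> p y" and ?K = "form_scale \<kappa>"
  note fs = model_form_model_dir_cosang[OF assms(1-5), folded C_def]
    model_form_model_dir_self[OF assms(1,2)] model_form_model_dir_self[OF assms(1,3)]
  have "sqrt (?K * ?a\<^sup>2) * sqrt (?K * ?b\<^sup>2) = ?K * (?a * ?b)"
    using sx sy form_scale_pos[of \<kappa>] by (simp add: real_sqrt_mult)
  then show eq: "model_angle \<kappa> p x y = arccos C"
    using sx sy form_scale_pos[of \<kappa>] unfolding model_angle_def Let_def fs by simp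
  \<comment> \<open>That \<open>C\<close> is a cosine at all is Cauchy-Schwarz in the tangent plane
    at \<open>p\<close>.\<close>
  have "(?K * (?a * ?b * C))\<^sup>2 \<le> (?K * ?a\<^sup>2) * (?K * ?b\<^sup>2)"
    using model_form_cauchy_schwarz[OF assms(1) tangent_model_dir tangent_model_dir, OF assms(1,1), of x y]
    unfolding fs .
  then have "C\<^sup>2 * (?K * (?a * ?b))\<^sup>2 \<le> 1 * (?K * (?a * ?b))\<^sup>2"
    by (simp add: power2_eq_square algebra_simps)
  then have "C\<^sup>2 \<le> 1"
    using sx sy form_scale_pos[of \<kappa>] by (subst (asm) mult_le_cancel_right_pos) auto
  then have "- 1 \<le> C" "C \<le> 1" by (auto simp: abs_square_le_1 abs_le_iff)
  then show "cos (model_angle \<kappa> p x y) = C"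
    "0 \<le> model_angle \<kappa> p x y" "model_angle \<kappa> p x y \<le> pi"
    unfolding eq by (auto intro: arccos_lbound arccos_ubound)
qed

text \<open>Since \<open>u\<close> lies between \<open>p\<close> and \<open>x\<close>,
  Cauchy-Schwarz is an equality for their directions at \<open>p\<close>: \<open>?w\<close> has
  length 0, so the directions are parallel and make the same angle with that of
  \<open>y\<close>.\<close>

lemma cosang_model_segment:
  assumes "p \<in> model_space \<kappa>" "x \<in> model_space \<kappa>" "y \<in> model_space \<kappa>" "u \<in> model_space \<kappa>"
    and sx: "sn \<kappa> (model_dist \<kappa> p x) > 0" and sy: "sn \<kappa> (model_dist \<kappa> p y) > 0"
    and su: "sn \<kappa> (model_dist \<kappa> p u) > 0"
    and between: "model_dist \<kappa> p u + model_dist \<kappa> u x = model_dist \<kappa> p x"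
  shows "cosang \<kappa> (model_dist \<kappa> p u) (model_dist \<kappa> p y) (model_dist \<kappa> u y) =
    cosang \<kappa> (model_dist \<kappa> p x) (model_dist \<kappa> p y) (model_dist \<kappa> x y)"
proof -
  let ?s = "\<lambda>x. sn \<kappa> (model_dist \<kappa> p x)" and ?d = "model_dir \<kappa> p"
  let ?w = "?s x *\<^sub>R ?d u - ?s u *\<^sub>R ?d x"
  have "md \<kappa> (model_dist \<kappa> u x) = md \<kappa> (model_dist \<kappa> p u - model_dist \<kappa> p x)"
    using between md_commute[of \<kappa> "model_dist \<kappa> p u"] by (metis add_diff_cancel_left')
  then have "cosang \<kappa> (model_dist \<kappa> p u) (model_dist \<kappa> p x) (model_dist \<kappa> u x) = 1"
    by (simp add: cosang_def)
  then have "model_form \<kappa> (?d u) (?d x) = form_scale \<kappa> * (?s u * ?s x)"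
    using model_form_model_dir_cosang[OF assms(1,4,2) su sx] by simp
  then have "model_form \<kappa> ?w ?w = 0"
    using model_form_model_dir_self[OF assms(1,4)] model_form_model_dir_self[OF assms(1,2)]
    by (simp add: model_form_linear model_form_commute[of \<kappa> "?d x" "?d u"] power2_eq_square)
  then have "?w = 0"
    using model_form_tangent_eq_0[OF assms(1)] tangent_linear tangent_model_dir[OF assms(1)] by metis
  then have "model_form \<kappa> ?w (?d y) = 0" by (simp add: model_form_def)
  then have "?s x * model_form \<kappa> (?d u) (?d y) = ?s u * model_form \<kappa> (?d x) (?d y)"
    by (simp add: model_form_linear)
  then show ?thesis
    unfolding model_form_model_dir_cosang[OF assms(1,4,3) su sy]
      model_form_model_dir_cosang[OF assms(1,2,3) sx sy]
    using su sx sy form_scale_pos[of \<kappa>] by simp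
qed

section \<open>Geodesic polar coordinates\<close>

text \<open>The centre is \<open>(0, 0, 1)\<close>, or the origin for \<open>\<kappa> = 0\<close>.
  Comparison triples and model segments are exhibited explicitly in these coordinates.\<close>

definition model_polar :: "real \<Rightarrow> real \<Rightarrow> real \<Rightarrow> real ^ 3" where
  "model_polar \<kappa> r \<phi> =
     (if \<kappa> > 0 then vector [sin (sqrt \<kappa> * r) * cos \<phi>, sin (sqrt \<kappa> * r) * sin \<phi>, cos (sqrt \<kappa> * r)]
      else if \<kappa> = 0 then vector [r * cos \<phi>, r * sin \<phi>, 0]
      else vector [sinh (sqrt (- \<kappa>) * r) * cos \<phi>, sinh (sqrt (- \<kappa>) * r) * sin \<phi>,
                   cosh (sqrt (- \<kappa>) * r)])"

lemma polar_identity: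
  "s * cos \<phi> * (t * cos \<psi>) + s * sin \<phi> * (t * sin \<psi>) = s * t * cos (\<phi> - \<psi>)" for s t \<phi> \<psi> :: real
  by (simp add: cos_diff algebra_simps)

lemma polar_identity_square: "(s * cos \<phi>)\<^sup>2 + (s * sin \<phi>)\<^sup>2 = s\<^sup>2" for s \<phi> :: real
  using polar_identity[of s \<phi> s \<phi>] by (simp add: power2_eq_square)

lemma model_polar_in_space: "model_polar \<kappa> r \<phi> \<in> model_space \<kappa>"
proof -
  consider "\<kappa> > 0" | "\<kappa> = 0" | "\<kappa> < 0" by linarith
  then show ?thesis
  proof cases
    case 1
    then show ?thesis
      by (simp add: model_space_def model_polar_def model_form_def inner_vec_def sum_3 polar_identity_square
          flip: power2_eq_square)
  next
    case 2
    then show ?thesis by (simp add: model_space_def model_polar_def)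
  next
    case 3
    then show ?thesis
      by (simp add: model_space_def model_polar_def model_form_def polar_identity_square
          cosh_square_eq flip: power2_eq_square)
  qed
qed

lemma md_model_dist_polar:
  "md \<kappa> (model_dist \<kappa> (model_polar \<kappa> r \<phi>) (model_polar \<kappa> t \<psi>)) = mdside \<kappa> r t (cos (\<phi> - \<psi>))"
proof -
  note m = md_model_dist[OF model_polar_in_space model_polar_in_space, of \<kappa> r \<phi> t \<psi>]
  consider "\<kappa> > 0" | "\<kappa> = 0" | "\<kappa> < 0" by linarith
  then show ?thesis
  proof cases
    case 1
    then have "sqrt \<kappa> * sqrt \<kappa> = \<kappa>" by simp
    then show ?thesis using 1 unfolding m mdside_def
      by (simp add: model_polar_def model_form_def inner_vec_def sum_3 polar_identity sn_def md_def
          right_diff_distrib cos_diff[of "sqrt \<kappa> * r"] divide_simps)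
  next
    case 2
    have [simp]: "cos x * cos x = 1 - sin x * sin x" for x :: real
      using sin_cos_squared_add[of x] by (simp add: power2_eq_square algebra_simps)
    have "(model_polar \<kappa> r \<phi> - model_polar \<kappa> t \<psi>) \<bullet> (model_polar \<kappa> r \<phi> - model_polar \<kappa> t \<psi>)
      = r * r + t * t - 2 * (r * t * cos (\<phi> - \<psi>))"
      using 2 by (simp add: model_polar_def inner_vec_def sum_3 cos_diff algebra_simps)
    then show ?thesis using 2 unfolding m mdside_def
      by (simp add: sn_def md_def power2_eq_square field_simps)
  next
    case 3
    then have "sqrt (-\<kappa>) * sqrt (-\<kappa>) = -\<kappa>" by simp
    then show ?thesis using 3 unfolding m mdside_def
      by (simp add: model_polar_def model_form_def polar_identity sn_def md_def
          right_diff_distrib cosh_diff divide_simps)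
  qed
qed

lemma model_polar_0: "model_polar \<kappa> 0 \<phi> = model_polar \<kappa> 0 0"
  by (simp add: model_polar_def)

lemma model_dist_polar_ray:
  assumes "0 \<le> r" "0 \<le> t" "ereal r \<le> model_diam \<kappa>" "ereal t \<le> model_diam \<kappa>"
  shows "model_dist \<kappa> (model_polar \<kappa> r \<phi>) (model_polar \<kappa> t \<phi>) = \<bar>r - t\<bar>"
proof (rule model_dist_eqI[OF model_polar_in_space model_polar_in_space])
  show "ereal \<bar>r - t\<bar> \<le> model_diam \<kappa>"
    by (rule order_trans[of _ "ereal (max r t)"]) (use assms in \<open>auto simp: max_def\<close>)
  show "md \<kappa> (model_dist \<kappa> (model_polar \<kappa> r \<phi>) (model_polar \<kappa> t \<phi>)) = md \<kappa> \<bar>r - t\<bar>"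
    by (simp add: md_model_dist_polar mdside_def md_abs)
qed auto

lemma model_dist_polar_origin:
  assumes "0 \<le> t" "ereal t \<le> model_diam \<kappa>"
  shows "model_dist \<kappa> (model_polar \<kappa> 0 0) (model_polar \<kappa> t \<phi>) = t"
  using model_dist_polar_ray[of 0 t \<kappa> \<phi>] assms order_trans[of "ereal 0" "ereal t"]
  by (simp add: model_polar_0[of \<kappa> \<phi>])

lemma model_segment_polar:
  assumes "0 \<le> a" "ereal a \<le> model_diam \<kappa>"
  shows "model_segment \<kappa> (model_polar \<kappa> 0 0) (model_polar \<kappa> a \<phi>) ((\<lambda>r. model_polar \<kappa> r \<phi>) ` {0..a})"
proof -
  have "ereal r \<le> model_diam \<kappa>" if "r \<le> a" for r
    using assms(2) that order_trans[of "ereal r" "ereal a"] by simp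
  then show ?thesis
    unfolding segment_in_def model_dist_polar_origin[OF assms]
    by (intro exI[of _ "\<lambda>r. model_polar \<kappa> r \<phi>"])
      (auto simp: model_polar_in_space model_polar_0[of \<kappa> \<phi>] intro!: model_dist_polar_ray)
qed

section \<open>Segments and angles in metric spaces\<close>

lemma segment_param:
  assumes "segment p x S"
  obtains \<gamma> where "S = \<gamma> ` {0..dist p x}" "\<gamma> 0 = p" "\<gamma> (dist p x) = x"
    "\<And>s t. s \<in> {0..dist p x} \<Longrightarrow> t \<in> {0..dist p x} \<Longrightarrow> dist (\<gamma> s) (\<gamma> t) = \<bar>s - t\<bar>"
    "\<And>t. t \<in> {0..dist p x} \<Longrightarrow> dist p (\<gamma> t) = t"
proof -
  obtain \<gamma> where \<gamma>: "S = \<gamma> ` {0..dist p x}" "\<gamma> 0 = p" "\<gamma> (dist p x) = x"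
    "\<And>s t. s \<in> {0..dist p x} \<Longrightarrow> t \<in> {0..dist p x} \<Longrightarrow> dist (\<gamma> s) (\<gamma> t) = \<bar>s - t\<bar>"
    using assms by (auto simp: segment_in_def)
  have "dist p (\<gamma> t) = t" if "t \<in> {0..dist p x}" for t
    using \<gamma>(4)[of 0 t] \<gamma>(2) that by auto
  with \<gamma> show ?thesis by (rule that)
qed

lemma segment_dist:
  assumes "segment p x S" "u \<in> S" "v \<in> S"
  shows "dist u v = \<bar>dist p u - dist p v\<bar>"
  using assms by (elim segment_param[of p x S]) auto

lemma segment_ends:
  assumes "segment p x S"
  shows "p \<in> S" "x \<in> S"
proof -
  obtain \<gamma> where "S = \<gamma> ` {0..dist p x}" "\<gamma> 0 = p" "\<gamma> (dist p x) = x"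
    using assms by (rule segment_param)
  moreover have "0 \<in> {0..dist p x}" "dist p x \<in> {0..dist p x}" by auto
  ultimately show "p \<in> S" "x \<in> S" by (metis imageI)+
qed

lemma segment_dist_le: "segment p x S \<Longrightarrow> u \<in> S \<Longrightarrow> dist p u \<le> dist p x"
  by (elim segment_param) auto

lemma segment_between:
  assumes "segment p x S" "u \<in> S"
  shows "dist p u + dist u x = dist p x"
  using segment_dist[OF assms(1,2) segment_ends(2)[OF assms(1)]] segment_dist_le[OF assms] by simp

lemma segment_point:
  assumes "segment p x S" "0 \<le> s" "s \<le> dist p x"
  obtains u where "u \<in> S" "dist p u = s"
proof -
  obtain \<gamma> where \<gamma>: "S = \<gamma> ` {0..dist p x}" "\<And>t. t \<in> {0..dist p x} \<Longrightarrow> dist p (\<gamma> t) = t"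
    using assms(1) by (rule segment_param) blast
  show ?thesis
    by (rule that[of "\<gamma> s"]) (use \<gamma> assms in auto)
qed

lemma segment_reverse:
  assumes "segment p x S"
  shows "segment x p S"
proof -
  obtain \<gamma> where \<gamma>: "S = \<gamma> ` {0..dist p x}" "\<gamma> 0 = p" "\<gamma> (dist p x) = x"
    "\<And>s t. s \<in> {0..dist p x} \<Longrightarrow> t \<in> {0..dist p x} \<Longrightarrow> dist (\<gamma> s) (\<gamma> t) = \<bar>s - t\<bar>"
    using assms by (rule segment_param) blast
  have "\<exists>\<gamma>'. \<gamma>' ` {0..dist p x} = S \<and> S \<subseteq> UNIV \<and> \<gamma>' 0 = x \<and> \<gamma>' (dist p x) = p \<and>
    (\<forall>s\<in>{0..dist p x}. \<forall>t\<in>{0..dist p x}. dist (\<gamma>' s) (\<gamma>' t) = \<bar>s - t\<bar>)"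
  proof (intro exI[of _ "\<lambda>t. \<gamma> (dist p x - t)"] conjI ballI)
    have "(\<lambda>t. dist p x - t) ` {0..dist p x} = {0..dist p x}"
      using image_diff_atLeastAtMost[of "dist p x" 0 "dist p x"] by simp
    then show "(\<lambda>t. \<gamma> (dist p x - t)) ` {0..dist p x} = S"
      unfolding \<gamma>(1) by (metis image_image)
  qed (use \<gamma> in auto)
  then show ?thesis unfolding segment_in_def by (simp only: dist_commute[of x p])
qed

lemma segment_initial:
  assumes S: "segment p x S" and u: "u \<in> S"
  shows "segment p u {w \<in> S. dist p w \<le> dist p u}"
proof -
  obtain \<gamma> where \<gamma>: "S = \<gamma> ` {0..dist p x}" "\<gamma> 0 = p"
    "\<And>s t. s \<in> {0..dist p x} \<Longrightarrow> t \<in> {0..dist p x} \<Longrightarrow> dist (\<gamma> s) (\<gamma> t) = \<bar>s - t\<bar>"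
    "\<And>t. t \<in> {0..dist p x} \<Longrightarrow> dist p (\<gamma> t) = t"
    using S by (rule segment_param) blast
  have le: "dist p u \<le> dist p x" by (rule segment_dist_le[OF S u])
  have "\<gamma> (dist p u) = u" using u \<gamma>(1,4) by auto
  then show ?thesis
    unfolding segment_in_def using le \<gamma> by (intro exI[of _ \<gamma>]) auto
qed

lemma segment_final:
  assumes S: "segment p x S" and u: "u \<in> S"
  shows "segment u x {w \<in> S. dist p u \<le> dist p w}"
proof -
  have "dist p u \<le> dist p w \<longleftrightarrow> dist x w \<le> dist x u" if "w \<in> S" for w
    using segment_between[OF S that] segment_between[OF S u] dist_commute[of x w] dist_commute[of x u]
    by linarith
  then have "{w \<in> S. dist p u \<le> dist p w} = {w \<in> S. dist x w \<le> dist x u}" by blast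
  then show ?thesis
    using segment_reverse[OF segment_initial[OF segment_reverse[OF S] u]] by simp
qed

lemma segment_islimpt:
  assumes S: "segment p x S" and "p \<noteq> x"
  shows "p islimpt S"
  unfolding islimpt_approachable
proof (intro allI impI)
  fix e :: real assume "e > 0"
  then have "0 \<le> min (e / 2) (dist p x)" "min (e / 2) (dist p x) \<le> dist p x"
    "0 < min (e / 2) (dist p x)" "min (e / 2) (dist p x) < e"
    using assms(2) by (auto simp: min_def)
  then show "\<exists>x'\<in>S. x' \<noteq> p \<and> dist x' p < e"
    by (metis segment_point[OF S] dist_commute dist_self less_irrefl)
qed

text \<open>The filter sees only points near \<open>p\<close>; hence the upper angle of a hinge does
  not change when a side is shortened.\<close>

lemma at_within_segment_initial:
  assumes "u \<noteq> p"
  shows "at p within {w \<in> S. dist p w \<le> dist p u} = at p within S"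
  by (rule at_within_nhd[of p "ball p (dist p u)"]) (use assms in auto)

section \<open>Comparison angles and the perimeter bound\<close>

abbreviation cosca :: "real \<Rightarrow> 'a::metric_space \<Rightarrow> 'a \<Rightarrow> 'a \<Rightarrow> real" where
  "cosca \<kappa> p x y \<equiv> cosang \<kappa> (dist p x) (dist p y) (dist x y)"

lemma cosca_commute: "cosca \<kappa> p x y = cosca \<kappa> p y x"
  by (simp add: cosang_commute dist_commute)

lemma per_commute: "per p x y = per p y x"
  by (simp add: per_def dist_commute)

text \<open>By the triangle inequality each side is at most half of the perimeter.\<close>

lemma per_less_diamD:
  assumes "ereal (per p x y) < 2 * model_diam \<kappa>"
  shows "ereal (dist p x) < model_diam \<kappa>" "ereal (dist p y) < model_diam \<kappa>"
    "ereal (dist x y) < model_diam \<kappa>"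
  using assms dist_triangle[of p x y] dist_triangle[of p y x] dist_triangle[of x y p]
  unfolding less_twice_model_diam_iff per_def
  by (auto elim!: less_model_diam_mono simp: dist_commute)

lemma per_less_diamI:
  assumes "a + b \<le> N" "ereal N < model_diam \<kappa>" "dist p x \<le> a" "dist p y \<le> b"
  shows "ereal (per p x y) < 2 * model_diam \<kappa>"
proof -
  have "per p x y / 2 \<le> N"
    using assms dist_triangle[of x y p] by (simp add: per_def dist_commute[of x p])
  then show ?thesis
    unfolding less_twice_model_diam_iff using assms(2) less_model_diam_mono by blast
qed

lemma hinge_sn_pos:
  assumes "p \<noteq> x" "p \<noteq> y" "ereal (per p x y) < 2 * model_diam \<kappa>"
  shows "sn \<kappa> (dist p x) > 0" "sn \<kappa> (dist p y) > 0"
  using per_less_diamD[OF assms(3)] assms(1,2) by (auto intro: sn_pos)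

lemma cosca_bounds:
  assumes "p \<noteq> x" "p \<noteq> y" "ereal (per p x y) < 2 * model_diam \<kappa>"
  shows "cosca \<kappa> p x y \<in> {-1..1}"
proof (rule cosang_bounds)
  show "ereal ((dist p x + dist p y + dist x y) / 2) < model_diam \<kappa>"
    using assms(3) unfolding less_twice_model_diam_iff per_def .
qed (use assms dist_triangle[of p x y] dist_triangle[of p y x] dist_triangle[of x y p]
    in \<open>auto simp: dist_commute\<close>)

lemma comparison_triple_polar:
  assumes "p \<noteq> x" "p \<noteq> y" "ereal (per p x y) < 2 * model_diam \<kappa>"
  shows "comparison_triple \<kappa> p x y (model_polar \<kappa> 0 0) (model_polar \<kappa> (dist p x) 0)
    (model_polar \<kappa> (dist p y) (arccos (cosca \<kappa> p x y)))"
proof -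
  note D = per_less_diamD[OF assms(3), THEN less_imp_le]
  have "md \<kappa> (model_dist \<kappa> (model_polar \<kappa> (dist p x) 0)
      (model_polar \<kappa> (dist p y) (arccos (cosca \<kappa> p x y)))) = md \<kappa> (dist x y)"
    using cosca_bounds[OF assms]
    by (simp add: md_model_dist_polar mdside_cosang hinge_sn_pos[OF assms])
  then show ?thesis
    unfolding comparison_triple_def using D
    by (auto simp: model_polar_in_space model_dist_polar_origin
        intro!: model_dist_eqI[OF model_polar_in_space model_polar_in_space])
qed

lemma comparison_triple_angle:
  assumes "p \<noteq> x" "p \<noteq> y" "ereal (per p x y) < 2 * model_diam \<kappa>"
    and "comparison_triple \<kappa> p x y p' x' y'"
  shows "model_angle \<kappa> p' x' y' = arccos (cosca \<kappa> p x y)"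
  using assms(4) hinge_sn_pos[OF assms(1-3)]
  by (auto simp: comparison_triple_def model_angle_eq(1))

lemma comparison_angle_eq:
  assumes "p \<noteq> x" "p \<noteq> y" "ereal (per p x y) < 2 * model_diam \<kappa>"
  shows "comparison_angle \<kappa> p x y = arccos (cosca \<kappa> p x y)"
  unfolding comparison_angle_def
  using comparison_triple_polar[OF assms] comparison_triple_angle[OF assms] by (intro the_equality) metis+

lemma comparison_angle_bounds:
  assumes "p \<noteq> x" "p \<noteq> y" "ereal (per p x y) < 2 * model_diam \<kappa>"
  shows "comparison_angle \<kappa> p x y \<in> {0..pi}"
  using cosca_bounds[OF assms] by (auto simp: comparison_angle_eq[OF assms] arccos_lbound arccos_ubound)

lemma comparison_angle_commute: "comparison_angle \<kappa> p x y = comparison_angle \<kappa> p y x"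
proof -
  have "comparison_triple \<kappa> p x y p' x' y' \<longleftrightarrow> comparison_triple \<kappa> p y x p' y' x'" for p' x' y'
    by (auto simp: comparison_triple_def dist_commute model_dist_commute)
  moreover have "model_angle \<kappa> p' x' y' = model_angle \<kappa> p' y' x'" for p' x' y'
    by (simp add: model_angle_def Let_def model_form_commute mult.commute)
  ultimately have "(\<exists>p' x' y'. comparison_triple \<kappa> p x y p' x' y' \<and> \<theta> = model_angle \<kappa> p' x' y') \<longleftrightarrow>
    (\<exists>p' x' y'. comparison_triple \<kappa> p y x p' x' y' \<and> \<theta> = model_angle \<kappa> p' x' y')" for \<theta>
    by metis
  then show ?thesis unfolding comparison_angle_def by simp
qed

section \<open>Upper angles\<close>

lemma Limsup_filtermap:
  fixes f :: "'b \<Rightarrow> 'c::complete_linorder"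
  shows "Limsup (filtermap g F) f = Limsup F (\<lambda>x. f (g x))"
  by (rule antisym) (auto simp: Limsup_le_iff eventually_filtermap dest: Limsup_lessD)

lemma hinge_angle_commute: "hinge_angle \<kappa> p S T = hinge_angle \<kappa> p T S"
  unfolding hinge_angle_def
  by (subst prod_filter_commute)
    (simp add: Limsup_filtermap comparison_angle_commute case_prod_unfold)

lemma hinge_commute: "hinge p x y S T \<longleftrightarrow> hinge p y x T S"
  by (auto simp: hinge_def)

lemma eventually_hingeI:
  assumes "\<delta> > 0"
    and "\<And>u v. u \<in> S \<Longrightarrow> v \<in> T \<Longrightarrow> u \<noteq> p \<Longrightarrow> v \<noteq> p \<Longrightarrow> dist p u < \<delta> \<Longrightarrow> dist p v < \<delta> \<Longrightarrow> P u v"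
  shows "eventually (\<lambda>(u, v). P u v) ((at p within S) \<times>\<^sub>F (at p within T))"
proof -
  have "eventually (\<lambda>u. u \<in> S \<and> u \<noteq> p \<and> dist p u < \<delta>) (at p within S)" for S
    unfolding eventually_at using assms(1) by (auto simp: dist_commute)
  from this[of S] this[of T] show ?thesis
    unfolding eventually_prod_filter using assms(2)
    by (intro exI[of _ "\<lambda>u. u \<in> S \<and> u \<noteq> p \<and> dist p u < \<delta>"] exI[of _ "\<lambda>v. v \<in> T \<and> v \<noteq> p \<and> dist p v < \<delta>"]) auto
qed

lemma small_per:
  "\<exists>\<delta>>0. \<forall>p x y :: 'a::metric_space. dist p x < \<delta> \<longrightarrow> dist p y < \<delta> \<longrightarrow> ereal (per p x y) < 2 * model_diam \<kappa>"
proof -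
  define \<delta> where "\<delta> = (if \<kappa> > 0 then pi / sqrt \<kappa> / 4 else 1)"
  have "\<delta> > 0" "ereal (2 * \<delta>) < model_diam \<kappa>"
    by (auto simp: \<delta>_def model_diam_def field_simps)
  then show ?thesis
    by (intro exI[of _ \<delta>] conjI allI impI per_less_diamI[of \<delta> \<delta> "2 * \<delta>"]) auto
qed

text \<open>Both sides accumulate at \<open>p\<close>, so the filter is proper and the upper limit
  inherits the bounds of the comparison angles. Its finiteness makes \<open>real_of_ereal\<close>
  harmless.\<close>

lemma hinge_angle_Limsup:
  fixes \<kappa> :: real
  assumes h: "hinge (p :: 'a::metric_space) x y S T"
  defines "L \<equiv> Limsup ((at p within S) \<times>\<^sub>F (at p within T)) (\<lambda>(u, v). ereal (comparison_angle \<kappa> p u v))"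
  shows "ereal (hinge_angle \<kappa> p S T) = L" "hinge_angle \<kappa> p S T \<in> {0..pi}"
proof -
  let ?F = "(at p within S) \<times>\<^sub>F (at p within T)"
  obtain \<delta> where "\<delta> > 0" and
    "\<forall>p x y :: 'a. dist p x < \<delta> \<longrightarrow> dist p y < \<delta> \<longrightarrow> ereal (per p x y) < 2 * model_diam \<kappa>"
    using small_per[of \<kappa>] by blast
  then have \<delta>: "\<delta> > 0"
    "\<And>x y. dist p x < \<delta> \<Longrightarrow> dist p y < \<delta> \<Longrightarrow> ereal (per p x y) < 2 * model_diam \<kappa>"
    by simp_all
  have ev: "eventually (\<lambda>(u, v). comparison_angle \<kappa> p u v \<in> {0..pi}) ?F"
    by (rule eventually_hingeI[OF \<delta>(1)]) (use comparison_angle_bounds \<delta>(2) in metis)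
  have "at p within S \<noteq> bot" "at p within T \<noteq> bot"
    using h segment_islimpt by (auto simp: hinge_def trivial_limit_within)
  then have "?F \<noteq> bot" by (simp add: prod_filter_eq_bot)
  then have "0 \<le> L" unfolding L_def
    by (intro le_Limsup) (use ev in \<open>auto elim!: eventually_mono\<close>)
  moreover have "L \<le> ereal pi" unfolding L_def
    by (intro Limsup_bounded) (use ev in \<open>auto elim!: eventually_mono\<close>)
  ultimately have "\<bar>L\<bar> \<noteq> \<infinity>" "0 \<le> real_of_ereal L" "real_of_ereal L \<le> pi"
    by (cases L; auto)+
  then show "ereal (hinge_angle \<kappa> p S T) = L" "hinge_angle \<kappa> p S T \<in> {0..pi}"
    by (auto simp: hinge_angle_def L_def ereal_real)
qed

lemma hinge_angle_ge:
  assumes h: "hinge p x y S T" and "\<delta> > 0"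
    and "\<And>u v. u \<in> S \<Longrightarrow> v \<in> T \<Longrightarrow> u \<noteq> p \<Longrightarrow> v \<noteq> p \<Longrightarrow> dist p u < \<delta> \<Longrightarrow> dist p v < \<delta> \<Longrightarrow>
      c \<le> comparison_angle \<kappa> p u v"
  shows "c \<le> hinge_angle \<kappa> p S T"
proof -
  have "at p within S \<noteq> bot" "at p within T \<noteq> bot"
    using h segment_islimpt by (auto simp: hinge_def trivial_limit_within)
  moreover have "eventually (\<lambda>(u, v). c \<le> comparison_angle \<kappa> p u v) ((at p within S) \<times>\<^sub>F (at p within T))"
    by (rule eventually_hingeI[OF assms(2)]) (use assms(3) in auto)
  ultimately have "ereal c \<le> ereal (hinge_angle \<kappa> p S T)"
    unfolding hinge_angle_Limsup(1)[OF h]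
    by (intro le_Limsup) (auto simp: prod_filter_eq_bot elim!: eventually_mono)
  then show ?thesis by simp
qed

lemma less_hinge_angleD:
  assumes h: "hinge p x y S T" and "\<delta> > 0" and "c < hinge_angle \<kappa> p S T"
  obtains u v where "u \<in> S" "v \<in> T" "u \<noteq> p" "v \<noteq> p" "dist p u < \<delta>" "dist p v < \<delta>"
    "c < comparison_angle \<kappa> p u v"
proof (rule ccontr)
  assume neg: "\<not> thesis"
  note wit = that
  have "comparison_angle \<kappa> p u v \<le> c"
    if "u \<in> S" "v \<in> T" "u \<noteq> p" "v \<noteq> p" "dist p u < \<delta>" "dist p v < \<delta>" for u v
    using wit[OF that] neg by (meson linorder_not_less)
  then have "eventually (\<lambda>(u, v). comparison_angle \<kappa> p u v \<le> c) ((at p within S) \<times>\<^sub>F (at p within T))"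
    by (rule eventually_hingeI[OF assms(2)])
  then have "ereal (hinge_angle \<kappa> p S T) \<le> ereal c"
    unfolding hinge_angle_Limsup(1)[OF h]
    by (intro Limsup_bounded) (auto elim!: eventually_mono)
  with assms(3) show False by simp
qed

section \<open>Property (D) as monotonicity of comparison angles\<close>

text \<open>(D) evaluated on the explicit polar triple. Stated with \<open>mdside\<close>, the
  conclusion stays meaningful for \<open>u = p\<close> or \<open>v = p\<close>, where
  \<open>cosca\<close> would divide by 0.\<close>

lemma distance_comparisonD:
  assumes h: "hinge p x y S T" and per: "ereal (per p x y) < 2 * model_diam \<kappa>"
    and D: "distance_comparison \<kappa> p x y S T" and u: "u \<in> S" and v: "v \<in> T"
  shows "mdside \<kappa> (dist p u) (dist p v) (cosca \<kappa> p x y) \<le> md \<kappa> (dist u v)"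
proof -
  let ?P = "model_polar \<kappa>" and ?\<theta> = "arccos (cosca \<kappa> p x y)"
  have ne: "p \<noteq> x" "p \<noteq> y" and S: "segment p x S" and T: "segment p y T"
    using h by (auto simp: hinge_def)
  note d = per_less_diamD[OF per, THEN less_imp_le]
  note le = segment_dist_le[OF S u] segment_dist_le[OF T v]
  have d': "ereal (dist p u) \<le> model_diam \<kappa>" "ereal (dist p v) \<le> model_diam \<kappa>"
    using d le by (auto intro: order_trans[of "ereal (dist p u)" "ereal (dist p x)"]
        order_trans[of "ereal (dist p v)" "ereal (dist p y)"])
  let ?u = "?P (dist p u) 0" and ?v = "?P (dist p v) ?\<theta>"
  have "model_dist \<kappa> ?u ?v \<le> dist u v"
    using D[unfolded distance_comparison_def, rule_format,
        OF conjI[OF comparison_triple_polar[OF ne per]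
          conjI[OF model_segment_polar[OF _ d(1)] model_segment_polar[OF _ d(2)]]], OF _ _ u v, of ?u ?v]
      le d' by (auto simp: model_dist_polar_origin)
  \<comment> \<open>Half of the perimeter bounds \<open>dist u v\<close>, which brings it into the
    range where \<open>md\<close> is increasing.\<close>
  moreover have "2 * dist u v \<le> per p x y"
    using dist_triangle[of u v p] dist_triangle[of u v x] dist_triangle[of x v y]
      segment_between[OF S u] segment_between[OF T v]
    by (simp add: per_def dist_commute)
  then have "ereal (dist u v) \<le> model_diam \<kappa>"
    using per unfolding less_twice_model_diam_iff by (intro less_imp_le) (auto elim: less_model_diam_mono)
  ultimately have "md \<kappa> (model_dist \<kappa> ?u ?v) \<le> md \<kappa> (dist u v)"
    by (subst md_le_iff) (auto simp: model_dist_nonneg model_dist_le_diam model_polar_in_space)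
  then show ?thesis
    using cosca_bounds[OF ne per] by (simp add: md_model_dist_polar)
qed

lemma distance_comparisonI:
  assumes h: "hinge p x y S T" and per: "ereal (per p x y) < 2 * model_diam \<kappa>"
    and le: "\<And>u v. u \<in> S \<Longrightarrow> v \<in> T \<Longrightarrow> u \<noteq> p \<Longrightarrow> v \<noteq> p \<Longrightarrow>
      cosca \<kappa> p u v \<le> cosca \<kappa> p x y"
  shows "distance_comparison \<kappa> p x y S T"
  unfolding distance_comparison_def
proof (intro allI impI ballI)
  fix p' x' y' S' T' u v u' v'
  assume A: "comparison_triple \<kappa> p x y p' x' y' \<and> model_segment \<kappa> p' x' S' \<and> model_segment \<kappa> p' y' T'"
    and u: "u \<in> S" and v: "v \<in> T" and u': "u' \<in> S'" and v': "v' \<in> T'"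
    and E: "dist p u = model_dist \<kappa> p' u' \<and> dist p v = model_dist \<kappa> p' v'"
  have ne: "p \<noteq> x" "p \<noteq> y" and S: "segment p x S" and T: "segment p y T"
    using h by (auto simp: hinge_def)
  have sp: "p' \<in> model_space \<kappa>" "x' \<in> model_space \<kappa>" "y' \<in> model_space \<kappa>"
    and d: "model_dist \<kappa> p' x' = dist p x" "model_dist \<kappa> p' y' = dist p y" "model_dist \<kappa> x' y' = dist x y"
    using A by (auto simp: comparison_triple_def)
  have seg: "w \<in> model_space \<kappa> \<and> model_dist \<kappa> p' w + model_dist \<kappa> w z = model_dist \<kappa> p' z"
    if W: "model_segment \<kappa> p' z W" "w \<in> W" for z w W
  proof -
    obtain \<gamma> where "\<gamma> ` {0..model_dist \<kappa> p' z} = W \<and> W \<subseteq> model_space \<kappa> \<and> \<gamma> 0 = p' \<and>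
      \<gamma> (model_dist \<kappa> p' z) = z \<and>
      (\<forall>s\<in>{0..model_dist \<kappa> p' z}. \<forall>t\<in>{0..model_dist \<kappa> p' z}. model_dist \<kappa> (\<gamma> s) (\<gamma> t) = \<bar>s - t\<bar>)"
      using W(1) unfolding segment_in_def by (rule exE)
    then have \<gamma>: "\<gamma> ` {0..model_dist \<kappa> p' z} = W" "W \<subseteq> model_space \<kappa>" "\<gamma> 0 = p'"
      "\<gamma> (model_dist \<kappa> p' z) = z"
      "\<forall>s\<in>{0..model_dist \<kappa> p' z}. \<forall>t\<in>{0..model_dist \<kappa> p' z}. model_dist \<kappa> (\<gamma> s) (\<gamma> t) = \<bar>s - t\<bar>"
      by auto
    obtain t where t: "t \<in> {0..model_dist \<kappa> p' z}" "w = \<gamma> t" using \<gamma>(1) W(2) by blast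
    then show ?thesis
      using \<gamma>(5)[rule_format, of 0 t] \<gamma>(5)[rule_format, of t "model_dist \<kappa> p' z"] \<gamma>(2-4) W(2)
      by auto
  qed
  have u2: "u' \<in> model_space \<kappa>" "model_dist \<kappa> p' u' + model_dist \<kappa> u' x' = model_dist \<kappa> p' x'"
    and v2: "v' \<in> model_space \<kappa>" "model_dist \<kappa> p' v' + model_dist \<kappa> v' y' = model_dist \<kappa> p' y'"
    using seg A u' v' by auto
  have dle: "ereal (dist p u) < model_diam \<kappa>" "ereal (dist p v) < model_diam \<kappa>"
    using per_less_diamD[OF per] segment_dist_le[OF S u] segment_dist_le[OF T v]
    by (auto elim: less_model_diam_mono)
  \<comment> \<open>For the degenerate case \<open>u = p\<close> or \<open>v = p\<close>, where
    there is no angle to compare.\<close>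
  have eq: "z = p'" if "z \<in> model_space \<kappa>" "model_dist \<kappa> p' z = 0" for z
  proof -
    have "model_form \<kappa> (model_dir \<kappa> p' z) (model_dir \<kappa> p' z) = 0"
      using model_form_model_dir_self[OF sp(1) that(1)] that(2) by simp
    then have *: "model_dir \<kappa> p' z = 0"
      using model_form_tangent_eq_0[OF sp(1) tangent_model_dir[OF sp(1)]] by simp
    have "md \<kappa> (model_dist \<kappa> p' z) = 0" using that(2) by simp
    then have "model_form \<kappa> z p' = (if \<kappa> < 0 then -1 else 1)" if "\<kappa> \<noteq> 0"
      using that unfolding md_model_dist[OF sp(1) \<open>z \<in> model_space \<kappa>\<close>]
      by (auto simp: model_form_commute[of \<kappa> z p'] split: if_splits)
    with * show ?thesis by (cases "\<kappa> = 0") (auto simp: model_dir_def split: if_splits)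
  qed
  show "model_dist \<kappa> u' v' \<le> dist u v"
  proof (cases "u = p \<or> v = p")
    case True
    then show ?thesis using eq[of u'] eq[of v'] E u2(1) v2(1)
      by (auto simp: model_dist_commute dist_commute)
  next
    case False
    have sx: "sn \<kappa> (dist p x) > 0" "sn \<kappa> (dist p y) > 0" by (rule hinge_sn_pos[OF ne per])+
    have su: "sn \<kappa> (dist p u) > 0" "sn \<kappa> (dist p v) > 0"
      using False dle by (auto intro!: sn_pos)
    \<comment> \<open>\<open>u'\<close> is moved out to \<open>x'\<close>, then \<open>v'\<close> to
      \<open>y'\<close>; neither changes the angle at \<open>p'\<close>.\<close>
    have "cosang \<kappa> (dist p u) (dist p v) (model_dist \<kappa> u' v') =
      cosang \<kappa> (dist p x) (dist p v) (model_dist \<kappa> x' v')"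
      using cosang_model_segment[OF sp(1,2) v2(1) u2(1) _ _ _ u2(2)] sx su d E by simp
    also have "\<dots> = cosca \<kappa> p x y"
      using cosang_model_segment[OF sp(1,3,2) v2(1) _ _ _ v2(2)] sx su d E
      by (simp add: model_dist_commute[of \<kappa> _ x'] cosang_commute[of \<kappa> "dist p x"])
    finally have "mdside \<kappa> (dist p u) (dist p v) (cosca \<kappa> p x y) = md \<kappa> (model_dist \<kappa> u' v')"
      using mdside_cosang[OF su] by metis
    then have "md \<kappa> (model_dist \<kappa> u' v') \<le> md \<kappa> (dist u v)"
      using le[OF u v] False mdside_le_md_iff[OF su] by metis
    moreover have "2 * dist u v \<le> per p x y"
      using dist_triangle[of u v p] dist_triangle[of u v x] dist_triangle[of x v y]
        segment_between[OF S u] segment_between[OF T v]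
      by (simp add: per_def dist_commute)
    then have "ereal (dist u v) \<le> model_diam \<kappa>"
      using per unfolding less_twice_model_diam_iff by (intro less_imp_le) (auto elim: less_model_diam_mono)
    ultimately show ?thesis
      by (subst (asm) md_le_iff) (auto simp: model_dist_nonneg model_dist_le_diam u2(1) v2(1))
  qed
qed

lemma cosca_mono:
  assumes h: "hinge p x y S T" and per: "ereal (per p x y) < 2 * model_diam \<kappa>"
    and D: "distance_comparison \<kappa> p x y S T"
    and u: "u \<in> S" "u \<noteq> p" and v: "v \<in> T" "v \<noteq> p"
  shows "cosca \<kappa> p u v \<le> cosca \<kappa> p x y"
proof -
  have S: "segment p x S" and T: "segment p y T" using h by (auto simp: hinge_def)
  have "ereal (dist p u) < model_diam \<kappa>" "ereal (dist p v) < model_diam \<kappa>"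
    using per_less_diamD[OF per] segment_dist_le[OF S u(1)] segment_dist_le[OF T v(1)]
    by (auto elim: less_model_diam_mono)
  then have "sn \<kappa> (dist p u) > 0" "sn \<kappa> (dist p v) > 0"
    using u(2) v(2) by (auto intro!: sn_pos)
  then show ?thesis
    using distance_comparisonD[OF h per D u(1) v(1)] mdside_le_md_iff by blast
qed

lemma per_subhinge:
  assumes h: "hinge p x y S T" and u: "u \<in> S" and v: "v \<in> T"
  shows "per p u v \<le> per p x y"
proof -
  have S: "segment p x S" and T: "segment p y T" using h by (auto simp: hinge_def)
  show ?thesis
    using dist_triangle[of u v x] dist_triangle[of x v y] segment_between[OF S u] segment_between[OF T v]
    by (simp add: per_def dist_commute)
qed

lemma per_subhinge_less:
  assumes "hinge p x y S T" "u \<in> S" "v \<in> T" "ereal (per p x y) < 2 * model_diam \<kappa>"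
  shows "ereal (per p u v) < 2 * model_diam \<kappa>"
  using per_subhinge[OF assms(1-3)] assms(4) by (metis ereal_less_eq(3) order_le_less_trans)

text \<open>By (D) no comparison angle between points on the sides is smaller than that of the
  endpoints, and the bound passes to the upper limit. It holds along the whole sides, so the radius
  1 is arbitrary.\<close>

lemma angle_comparison_if_distance_comparison:
  assumes h: "hinge p x y S T" and per: "ereal (per p x y) < 2 * model_diam \<kappa>"
    and D: "distance_comparison \<kappa> p x y S T"
  shows "angle_comparison \<kappa> p x y S T"
  unfolding angle_comparison_def
proof (rule hinge_angle_ge[OF h zero_less_one])
  fix u v assume uv: "u \<in> S" "v \<in> T" "u \<noteq> p" "v \<noteq> p"
  have ne: "p \<noteq> x" "p \<noteq> y" using h by (auto simp: hinge_def)
  have per': "ereal (per p u v) < 2 * model_diam \<kappa>" by (rule per_subhinge_less[OF h uv(1,2) per])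
  show "comparison_angle \<kappa> p x y \<le> comparison_angle \<kappa> p u v"
    using cosca_mono[OF h per D uv(1,3,2,4)] cosca_bounds[OF ne per]
      cosca_bounds[OF uv(3,4)[symmetric] per']
    unfolding comparison_angle_eq[OF ne per] comparison_angle_eq[OF uv(3,4)[symmetric] per']
    by (auto intro: arccos_le_arccos)
qed

text \<open>\<open>md\<close> of the third side of the comparison hinge; this avoids naming that side.\<close>

definition hinge_md :: "real \<Rightarrow> 'a::metric_space \<Rightarrow> 'a \<Rightarrow> 'a \<Rightarrow> 'a set \<Rightarrow> 'a set \<Rightarrow> real" where
  "hinge_md \<kappa> p x y S T = mdside \<kappa> (dist p x) (dist p y) (cos (hinge_angle \<kappa> p S T))"

lemma hinge_md_commute: "hinge_md \<kappa> p x y S T = hinge_md \<kappa> p y x T S"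
  unfolding hinge_md_def by (simp add: mdside_commute hinge_angle_commute)

text \<open>Both \<open>mdside\<close> in its last argument and \<open>cos\<close> on
  \<open>[0, \<pi>]\<close> are decreasing, so (A) and (H), the latter read through
  \<open>md\<close>, are the same inequality.\<close>

lemma hinge_md_iff:
  assumes h: "hinge p x y S T" and per: "ereal (per p x y) < 2 * model_diam \<kappa>"
  shows "md \<kappa> (dist x y) \<le> hinge_md \<kappa> p x y S T \<longleftrightarrow> cos (hinge_angle \<kappa> p S T) \<le> cosca \<kappa> p x y"
    and "md \<kappa> (dist x y) \<le> hinge_md \<kappa> p x y S T \<longleftrightarrow> angle_comparison \<kappa> p x y S T"
proof -
  have ne: "p \<noteq> x" "p \<noteq> y" using h by (auto simp: hinge_def)
  show 1: "md \<kappa> (dist x y) \<le> hinge_md \<kappa> p x y S T \<longleftrightarrow> cos (hinge_angle \<kappa> p S T) \<le> cosca \<kappa> p x y"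
    unfolding hinge_md_def by (rule md_le_mdside_iff[OF hinge_sn_pos[OF ne per]])
  have "cos (hinge_angle \<kappa> p S T) \<le> cos (arccos (cosca \<kappa> p x y)) \<longleftrightarrow>
    arccos (cosca \<kappa> p x y) \<le> hinge_angle \<kappa> p S T"
    using hinge_angle_Limsup(2)[OF h, of \<kappa>] cosca_bounds[OF ne per]
    by (intro cos_mono_le_eq) (auto simp: arccos_lbound arccos_ubound)
  then show "md \<kappa> (dist x y) \<le> hinge_md \<kappa> p x y S T \<longleftrightarrow> angle_comparison \<kappa> p x y S T"
    using cosca_bounds[OF ne per] unfolding 1 angle_comparison_def comparison_angle_eq[OF ne per] by simp
qed

lemma hinge_comparisonI:
  assumes h: "hinge p x y S T" and per: "ereal (per p x y) < 2 * model_diam \<kappa>"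
    and le: "md \<kappa> (dist x y) \<le> hinge_md \<kappa> p x y S T"
  shows "hinge_comparison \<kappa> p x y S T"
  unfolding hinge_comparison_def
proof (intro allI impI)
  fix p' x' y' assume A: "comparison_hinge \<kappa> p x y S T p' x' y'"
  have ne: "p \<noteq> x" "p \<noteq> y" using h by (auto simp: hinge_def)
  note s = hinge_sn_pos[OF ne per]
  have sp: "p' \<in> model_space \<kappa>" "x' \<in> model_space \<kappa>" "y' \<in> model_space \<kappa>"
    and d: "model_dist \<kappa> p' x' = dist p x" "model_dist \<kappa> p' y' = dist p y"
    "model_angle \<kappa> p' x' y' = hinge_angle \<kappa> p S T"
    using A by (auto simp: comparison_hinge_def)
  have "cos (hinge_angle \<kappa> p S T) = cosang \<kappa> (dist p x) (dist p y) (model_dist \<kappa> x' y')"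
    using model_angle_eq(2)[OF sp] s d by simp
  then have "hinge_md \<kappa> p x y S T = md \<kappa> (model_dist \<kappa> x' y')"
    using mdside_cosang[OF s] by (simp add: hinge_md_def)
  with le have "md \<kappa> (dist x y) \<le> md \<kappa> (model_dist \<kappa> x' y')" by simp
  then show "dist x y \<le> model_dist \<kappa> x' y'"
    using per_less_diamD(3)[OF per] sp
    by (subst (asm) md_le_iff) (auto simp: model_dist_nonneg model_dist_le_diam)
qed

text \<open>Alexandrov's lemma.\<close>

lemma cosang_sum_nonneg_iff:
  assumes "0 < s" "0 < t" "0 < h" "0 < a"
    and D: "ereal (s + t) < model_diam \<kappa>" "ereal h < model_diam \<kappa>" "ereal a < model_diam \<kappa>"
  shows "0 \<le> cosang \<kappa> s h a + cosang \<kappa> t h b \<longleftrightarrow>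
    mdside \<kappa> s a (cosang \<kappa> (s + t) a b) \<le> md \<kappa> h"
proof -
  have pos: "sn \<kappa> s > 0" "sn \<kappa> t > 0" "sn \<kappa> h > 0" "sn \<kappa> a > 0" "sn \<kappa> (s + t) > 0"
    using assms by (auto intro!: sn_pos elim: less_model_diam_mono)
  \<comment> \<open>Subtracting the two Stewart relations cancels all but these terms: the defect of
    the angles at the foot on the left, the defect of the distance to the foot on the right.\<close>
  have "sn \<kappa> s * sn \<kappa> t * sn \<kappa> h * (cosang \<kappa> s h a + cosang \<kappa> t h b) =
    sn \<kappa> (s + t) * (md \<kappa> h - mdside \<kappa> s a (cosang \<kappa> (s + t) a b))"
    using stewart_at_foot[of \<kappa> t s h "cosang \<kappa> s h a" "cosang \<kappa> t h b"]
      stewart_at_end[of \<kappa> t a s "cosang \<kappa> (s + t) a b"]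
    unfolding mdside_cosang[OF pos(1,3)] mdside_cosang[OF pos(2,3)] mdside_cosang[OF pos(5,4)]
    by (simp add: algebra_simps)
  moreover have "sn \<kappa> s * sn \<kappa> t * sn \<kappa> h > 0" using pos by simp
  ultimately show ?thesis using pos(5)
    by (metis diff_ge_0_iff_ge zero_le_mult_iff not_less order_less_imp_le)
qed

section \<open>Globalisation\<close>

text \<open>Property (D) at \<open>a\<close> bounds \<open>dist v u\<close> from below, and
  Alexandrov's lemma turns this into a bound by \<pi> for the sum of the comparison angles at
  \<open>v\<close>, expressed by cosines. \<open>D\<close> is conditional because
  \<open>u = a\<close> leaves no hinge at \<open>a\<close>; then one of the cosines is 1.\<close>

lemma adjacent_cosca:
  assumes S: "segment a b S" and v: "v \<in> S" "v \<noteq> a" "v \<noteq> b" and u: "u \<noteq> v"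
    and W: "segment a u W" and per: "ereal (per a b u) < 2 * model_diam \<kappa>"
    and D: "hinge a b u S W \<Longrightarrow> distance_comparison \<kappa> a b u S W"
  shows "0 \<le> cosca \<kappa> v a u + cosca \<kappa> v b u"
proof (cases "u = a")
  case True
  have "per v b a = per a b u"
    using segment_between[OF S v(1)] True by (simp add: per_def dist_commute)
  with per have "ereal (per v b a) < 2 * model_diam \<kappa>" by simp
  then have "-1 \<le> cosca \<kappa> v b a" using cosca_bounds[of v b a \<kappa>] v by simp
  moreover have "cosca \<kappa> v a a = 1" by (simp add: cosang_def)
  ultimately show ?thesis using True by simp
next
  case False
  have ab: "dist v a + dist v b = dist a b" using segment_between[OF S v(1)] by (simp add: dist_commute)
  have "a \<noteq> b" using ab v by (metis add_nonneg_eq_0_iff dist_eq_0_iff zero_le_dist)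
  with False have h: "hinge a b u S W" using S W by (simp add: hinge_def)
  have "2 * dist v u \<le> per a b u"
    using dist_triangle[of v u a] dist_triangle[of v u b] ab by (simp add: per_def dist_commute)
  then have vu: "ereal (dist v u) < model_diam \<kappa>"
    using per unfolding less_twice_model_diam_iff by (auto elim: less_model_diam_mono)
  have "mdside \<kappa> (dist v a) (dist a u) (cosang \<kappa> (dist v a + dist v b) (dist a u) (dist b u)) \<le> md \<kappa> (dist v u)"
    using distance_comparisonD[OF h per D[OF h] v(1) segment_ends(2)[OF W]] ab
    by (simp add: dist_commute)
  moreover have "0 < dist v a" "0 < dist v b" "0 < dist v u" "0 < dist a u"
    using v u False by auto
  ultimately show ?thesis
    using cosang_sum_nonneg_iff[of "dist v a" "dist v b" "dist v u" "dist a u" \<kappa> "dist b u"]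
      per_less_diamD[OF per] vu ab by simp
qed

lemma arccos_add_le_pi_iff:
  assumes "x \<in> {-1..1}" "y \<in> {-1..1}"
  shows "arccos x + arccos y \<le> pi \<longleftrightarrow> 0 \<le> x + y"
proof -
  have "\<bar>x\<bar> \<le> 1" "\<bar>- y\<bar> \<le> 1" using assms by auto
  then show ?thesis using arccos_le_mono[of x "- y"] arccos_minus[of y] assms by auto
qed

text \<open>The two upper angles may be approached along different points \<open>u1\<close> and
  \<open>u2\<close> of \<open>W\<close>. By (D) comparison angles do not decrease as endpoints move
  towards \<open>v\<close>, so both can be evaluated at a common \<open>u'\<close>, to which
  \<open>adjacent_cosca\<close> applies.\<close>

lemma adjacent_angles:
  fixes v p q u :: "'a::metric_space"
  assumes \<rho>: "\<rho> > 0"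
    and per: "\<And>p x y. p \<in> ball v \<rho> \<Longrightarrow> x \<in> ball v \<rho> \<Longrightarrow> y \<in> ball v \<rho> \<Longrightarrow>
      ereal (per p x y) < 2 * model_diam \<kappa>"
    and D: "\<And>p x y S T. p \<in> ball v \<rho> \<Longrightarrow> x \<in> ball v \<rho> \<Longrightarrow> y \<in> ball v \<rho> \<Longrightarrow>
      hinge p x y S T \<Longrightarrow> distance_comparison \<kappa> p x y S T"
    and seg: "\<And>a b :: 'a. ereal (dist a b) < model_diam \<kappa> \<Longrightarrow> \<exists>S. segment a b S"
    and S: "segment p q S" and v: "v \<in> S" "v \<noteq> p" "v \<noteq> q"
    and W: "segment v u W" "u \<noteq> v"
  shows "hinge_angle \<kappa> v {w \<in> S. dist p w \<le> dist p v} W +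
    hinge_angle \<kappa> v {w \<in> S. dist p v \<le> dist p w} W \<le> pi"
    (is "hinge_angle \<kappa> v ?S1 W + hinge_angle \<kappa> v ?S2 W \<le> pi")
proof (rule ccontr)
  assume neg: "\<not> ?thesis"
  \<comment> \<open>Half of the excess over \<pi>, so that an error of \<open>e\<close> in each
    angle still leads to a contradiction.\<close>
  define e where "e = (hinge_angle \<kappa> v ?S1 W + hinge_angle \<kappa> v ?S2 W - pi) / 2"
  have e: "e > 0" using neg by (simp add: e_def)
  have S1: "segment v p ?S1" by (rule segment_reverse[OF segment_initial[OF S v(1)]])
  have S2: "segment v q ?S2" by (rule segment_final[OF S v(1)])
  have h1: "hinge v p u ?S1 W" and h2: "hinge v q u ?S2 W"
    using S1 S2 W v by (auto simp: hinge_def)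
  obtain a u1 where a: "a \<in> ?S1" "a \<noteq> v" "dist v a < \<rho>" and u1: "u1 \<in> W" "u1 \<noteq> v" "dist v u1 < \<rho>"
    and au1: "hinge_angle \<kappa> v ?S1 W - e < comparison_angle \<kappa> v a u1"
    by (rule less_hinge_angleD[OF h1 \<rho>, of "hinge_angle \<kappa> v ?S1 W - e" \<kappa>]) (use e in simp)
  obtain b u2 where b: "b \<in> ?S2" "b \<noteq> v" "dist v b < \<rho>" and u2: "u2 \<in> W" "u2 \<noteq> v" "dist v u2 < \<rho>"
    and bu2: "hinge_angle \<kappa> v ?S2 W - e < comparison_angle \<kappa> v b u2"
    by (rule less_hinge_angleD[OF h2 \<rho>, of "hinge_angle \<kappa> v ?S2 W - e" \<kappa>]) (use e in simp)
  obtain u' where u': "u' \<in> W" "u' \<noteq> v" "dist v u' < \<rho>" "dist v u' \<le> dist v u1" "dist v u' \<le> dist v u2"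
    using u1 u2 by (metis linear)
  have mono: "comparison_angle \<kappa> v a0 u0 \<le> arccos (cosca \<kappa> v a0 u')"
      "cosca \<kappa> v a0 u' \<in> {-1..1}"
    if "segment v p0 R" "a0 \<in> R" "a0 \<noteq> v" "dist v a0 < \<rho>" "u0 \<in> W" "u0 \<noteq> v" "dist v u0 < \<rho>"
      "dist v u' \<le> dist v u0" for p0 R a0 u0
  proof -
    have h: "hinge v a0 u0 {w \<in> R. dist v w \<le> dist v a0} {w \<in> W. dist v w \<le> dist v u0}"
      using that segment_initial[OF that(1,2)] segment_initial[OF W(1) that(5)] by (auto simp: hinge_def)
    have in_ball: "v \<in> ball v \<rho>" "a0 \<in> ball v \<rho>" "u0 \<in> ball v \<rho>" "u' \<in> ball v \<rho>"
      using \<rho> that u' by auto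
    note p0 = per[OF in_ball(1-3)] and p' = per[OF in_ball(1,2,4)]
    have "cosca \<kappa> v a0 u' \<le> cosca \<kappa> v a0 u0"
      using that u' by (intro cosca_mono[OF h p0 D[OF in_ball(1-3) h]]) auto
    moreover show "cosca \<kappa> v a0 u' \<in> {-1..1}"
      using that u' by (intro cosca_bounds[OF _ _ p']) auto
    moreover have "cosca \<kappa> v a0 u0 \<in> {-1..1}"
      using that by (intro cosca_bounds[OF _ _ p0]) auto
    ultimately show "comparison_angle \<kappa> v a0 u0 \<le> arccos (cosca \<kappa> v a0 u')"
      using comparison_angle_eq[OF _ _ p0] that by (auto intro: arccos_le_arccos)
  qed
  note ma = mono[OF S1 a u1 u'(4)] and mb = mono[OF S2 b u2 u'(5)]
  have in_ball: "v \<in> ball v \<rho>" "a \<in> ball v \<rho>" "b \<in> ball v \<rho>" "u' \<in> ball v \<rho>"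
    using \<rho> a b u' by auto
  \<comment> \<open>Cutting \<open>S\<close> at \<open>a\<close> and then at \<open>b\<close> leaves
    \<open>?B\<close>, the part of \<open>S\<close> around \<open>v\<close>.\<close>
  let ?A = "{w \<in> S. dist p a \<le> dist p w}"
  let ?B = "{w \<in> ?A. dist a w \<le> dist a b}"
  have aS: "a \<in> S" and bA: "b \<in> ?A" and vA: "v \<in> ?A" using a b v by auto
  have B: "segment a b ?B" by (rule segment_initial[OF segment_final[OF S aS] bA])
  have vB: "v \<in> ?B"
    using vA segment_dist[OF S aS v(1)] segment_dist[OF S aS, of b] a b by auto
  obtain V where V: "segment a u' V"
    using seg[OF per_less_diamD(2)[OF per[OF in_ball(2,3,4)]]] by blast
  have "0 \<le> cosca \<kappa> v a u' + cosca \<kappa> v b u'"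
    by (rule adjacent_cosca[OF B vB _ _ u'(2) V per[OF in_ball(2,3,4)] D[OF in_ball(2,3,4)]])
      (use a b in auto)
  then have "arccos (cosca \<kappa> v a u') + arccos (cosca \<kappa> v b u') \<le> pi"
    using arccos_add_le_pi_iff[OF ma(2) mb(2)] by simp
  then show False
    using ma(1) mb(1) au1 bu2 by (simp add: e_def field_simps)
qed

section \<open>Moving the vertex of a violating hinge\<close>

text \<open>In the application \<open>a\<close> and \<open>h\<close> are the distances of
  \<open>p\<close> from the old and the new vertex, \<open>s\<close> is the step, \<open>t\<close>
  the rest of the side towards \<open>q\<close>, and \<open>c\<close>, \<open>c'\<close> are the
  cosines of the two angles. Equality in both angle assumptions would give the two hinges the same
  third side (\<open>eq\<close>); the first inequality then follows by monotonicity in the cosine.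
  The second compares with the straight hinge.\<close>

lemma mdside_step:
  assumes "sn \<kappa> s > 0" "sn \<kappa> t > 0" "sn \<kappa> a > 0" "sn \<kappa> h > 0" "sn \<kappa> (s + t) > 0"
    and c: "c \<le> cosang \<kappa> s a h" and c': "- c' \<le> cosang \<kappa> s h a"
  shows "mdside \<kappa> h t c' \<le> mdside \<kappa> a (s + t) c"
    and "sn \<kappa> s * (md \<kappa> (a + (s + t)) - mdside \<kappa> a (s + t) c) \<le>
      sn \<kappa> (s + t) * (md \<kappa> (a + s) - md \<kappa> h)"
proof -
  let ?Y = "cosang \<kappa> s a h" and ?X = "cosang \<kappa> s h a"
  have Y: "sn \<kappa> t * md \<kappa> a + sn \<kappa> s * mdside \<kappa> (s + t) a ?Y =
      sn \<kappa> (s + t) * md \<kappa> h + sn \<kappa> s * md \<kappa> t + sn \<kappa> t * md \<kappa> s"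
    using stewart_at_end[of \<kappa> t a s ?Y] mdside_cosang[OF assms(1,3)] by simp
  moreover have "sn \<kappa> t * md \<kappa> a + sn \<kappa> s * mdside \<kappa> t h (- ?X) =
      sn \<kappa> (s + t) * md \<kappa> h + sn \<kappa> s * md \<kappa> t + sn \<kappa> t * md \<kappa> s"
    using stewart_at_foot[of \<kappa> t s h ?X "- ?X"] mdside_cosang[OF assms(1,4)] by simp
  ultimately have eq: "mdside \<kappa> t h (- ?X) = mdside \<kappa> (s + t) a ?Y"
    using assms(1) by (metis add_left_cancel less_irrefl mult_left_cancel)
  have le: "mdside \<kappa> (s + t) a ?Y \<le> mdside \<kappa> (s + t) a c"
    using c by (simp add: mdside_le_iff[OF assms(5,3)])
  have "mdside \<kappa> t h c' \<le> mdside \<kappa> t h (- ?X)"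
    using c' by (simp add: mdside_le_iff[OF assms(2,4)])
  with le eq show "mdside \<kappa> h t c' \<le> mdside \<kappa> a (s + t) c"
    by (simp add: mdside_commute[of \<kappa> h] mdside_commute[of \<kappa> a])
  have straight: "mdside \<kappa> x y (- 1) = md \<kappa> (x + y)" for x y
    using md_add_minus_md_diff[of \<kappa> x y] by (simp add: mdside_def)
  \<comment> \<open>Stewart's relation for the straight hinge, from which \<open>Y\<close> is
    subtracted.\<close>
  have "sn \<kappa> t * md \<kappa> a + sn \<kappa> s * md \<kappa> (s + t + a) =
      sn \<kappa> (s + t) * md \<kappa> (s + a) + sn \<kappa> s * md \<kappa> t + sn \<kappa> t * md \<kappa> s"
    using stewart_at_end[of \<kappa> t a s "-1"] unfolding straight .
  with Y have "sn \<kappa> s * (md \<kappa> (a + (s + t)) - mdside \<kappa> (s + t) a ?Y) =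
      sn \<kappa> (s + t) * (md \<kappa> (a + s) - md \<kappa> h)"
    by (simp add: algebra_simps)
  moreover have "sn \<kappa> s * (md \<kappa> (a + (s + t)) - mdside \<kappa> a (s + t) c) \<le>
      sn \<kappa> s * (md \<kappa> (a + (s + t)) - mdside \<kappa> (s + t) a ?Y)"
    using le assms(1) by (intro mult_left_mono) (auto simp: mdside_commute[of \<kappa> a])
  ultimately show "sn \<kappa> s * (md \<kappa> (a + (s + t)) - mdside \<kappa> a (s + t) c) \<le>
      sn \<kappa> (s + t) * (md \<kappa> (a + s) - md \<kappa> h)" by simp
qed

context
  fixes \<kappa> :: real
  assumes curv: "alexandrov_curvature_ge TYPE('a::complete_space) \<kappa>"
    and seg: "\<And>a b :: 'a. ereal (dist a b) < model_diam \<kappa> \<Longrightarrow> \<exists>S. segment a b S"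
begin

text \<open>The perimeter condition is absorbed into the radius: any two points of the ball are
  closer than \<open>\<delta>\<close>.\<close>

lemma local_comparison:
  fixes q :: 'a
  obtains \<rho> where "\<rho> > 0"
    "\<And>p x y. p \<in> ball q \<rho> \<Longrightarrow> x \<in> ball q \<rho> \<Longrightarrow> y \<in> ball q \<rho> \<Longrightarrow> ereal (per p x y) < 2 * model_diam \<kappa>"
    "\<And>p x y S T. p \<in> ball q \<rho> \<Longrightarrow> x \<in> ball q \<rho> \<Longrightarrow> y \<in> ball q \<rho> \<Longrightarrow>
      hinge p x y S T \<Longrightarrow> distance_comparison \<kappa> p x y S T"
proof -
  obtain U where U: "q \<in> interior U"
    "\<And>p x y S T. p \<in> U \<Longrightarrow> x \<in> U \<Longrightarrow> y \<in> U \<Longrightarrow> hinge p x y S T \<Longrightarrow>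
      ereal (per p x y) < 2 * model_diam \<kappa> \<Longrightarrow> distance_comparison \<kappa> p x y S T"
    using curv unfolding alexandrov_curvature_ge_def by metis
  obtain r where r: "r > 0" "ball q r \<subseteq> U"
    using U(1) unfolding mem_interior by blast
  obtain \<delta> where \<delta>: "\<delta> > 0"
    "\<forall>p x y :: 'a. dist p x < \<delta> \<longrightarrow> dist p y < \<delta> \<longrightarrow> ereal (per p x y) < 2 * model_diam \<kappa>"
    using small_per[of \<kappa>] by blast
  define \<rho> where "\<rho> = min r (\<delta> / 2)"
  have "dist p x < \<delta>" if "p \<in> ball q \<rho>" "x \<in> ball q \<rho>" for p x
    using that dist_triangle[of p x q] by (simp add: \<rho>_def dist_commute)
  then have per: "ereal (per p x y) < 2 * model_diam \<kappa>"
    if "p \<in> ball q \<rho>" "x \<in> ball q \<rho>" "y \<in> ball q \<rho>" for p x y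
    using \<delta>(2) that by blast
  have in_U: "p \<in> U" if "p \<in> ball q \<rho>" for p
    using that r(2) by (auto simp: \<rho>_def)
  have "\<rho> > 0" using r \<delta> by (simp add: \<rho>_def)
  then show ?thesis
    by (rule that[OF _ per U(2)[OF in_U in_U in_U _ per]])
qed

lemma adjacent_angles_le_pi:
  fixes p q :: 'a
  assumes S: "segment p q S" and v: "v \<in> S" "v \<noteq> p" "v \<noteq> q" and W: "segment v u W" "u \<noteq> v"
  shows "hinge_angle \<kappa> v {w \<in> S. dist p w \<le> dist p v} W +
    hinge_angle \<kappa> v {w \<in> S. dist p v \<le> dist p w} W \<le> pi"
proof -
  obtain \<rho> where \<rho>: "\<rho> > 0"
    "\<And>p x y. p \<in> ball v \<rho> \<Longrightarrow> x \<in> ball v \<rho> \<Longrightarrow> y \<in> ball v \<rho> \<Longrightarrow> ereal (per p x y) < 2 * model_diam \<kappa>"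
    "\<And>p x y S T. p \<in> ball v \<rho> \<Longrightarrow> x \<in> ball v \<rho> \<Longrightarrow> y \<in> ball v \<rho> \<Longrightarrow>
      hinge p x y S T \<Longrightarrow> distance_comparison \<kappa> p x y S T"
    using local_comparison[of v] by metis
  show ?thesis by (rule adjacent_angles[OF \<rho> seg S v W])
qed

text \<open>
  The conclusion in \<open>sn \<kappa> s\<close> bounds how little the sum of the two sides can drop: if it drops by almost
  nothing, the old hinge is nearly straight and its comparison side is nearly \<open>dist x p + dist x q\<close>.
\<close>

lemma shorter_hinge:
  fixes x p q :: 'a
  assumes h: "hinge x p q S T" and per: "ereal (per x p q) < 2 * model_diam \<kappa>"
    and le: "dist x p \<le> dist x q"
    and N: "dist x p < N" "ereal N \<le> model_diam \<kappa>" "N \<le> dist x p + dist x q"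
    and nov: "\<forall>z y w Z W. hinge z y w Z W \<longrightarrow> dist z y + dist z w < N \<longrightarrow> dist x z < N \<longrightarrow>
      md \<kappa> (dist y w) \<le> hinge_md \<kappa> z y w Z W"
    and viol: "hinge_md \<kappa> x p q S T < md \<kappa> (dist p q)"
  defines "s \<equiv> (N - dist x p) / 3"
  obtains x' S' T' where "hinge x' p q S' T'" "hinge_md \<kappa> x' p q S' T' \<le> hinge_md \<kappa> x p q S T"
    "dist x' q = dist x q - s" "dist x' p \<le> dist x p + s"
    "sn \<kappa> s * (md \<kappa> (dist x p + dist x q) - hinge_md \<kappa> x p q S T) \<le>
      sn \<kappa> (dist x q) * (md \<kappa> (dist x p + s) - md \<kappa> (dist x' p))"
proof -
  have S: "segment x p S" and T: "segment x q T" and ne: "x \<noteq> p" "x \<noteq> q"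
    using h by (auto simp: hinge_def)
  \<comment> \<open>As \<open>N\<close> is at most the sum of the sides, the step is at most a third
    of the longer side.\<close>
  have s: "s > 0" "s < dist x q" using N le ne by (auto simp: s_def)
  obtain x' where x': "x' \<in> T" "dist x x' = s"
    using segment_point[OF T, of s] s by auto
  have x'q: "dist x' q = dist x q - s" using segment_between[OF T x'(1)] x'(2) by simp
  have nex': "x' \<noteq> x" "x' \<noteq> q" using s x' by auto
  have h_le: "dist x' p \<le> dist x p + s" using dist_triangle[of x' p x] x' by (simp add: dist_commute)
  let ?T1 = "{w \<in> T. dist x w \<le> dist x x'}" and ?T2 = "{w \<in> T. dist x x' \<le> dist x w}"
  have T1: "segment x x' ?T1" and T2: "segment x' q ?T2"
    using segment_initial[OF T x'(1)] segment_final[OF T x'(1)] by auto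
  have angle_bounds: "hinge_angle \<kappa> x S T \<in> {0..pi}" by (rule hinge_angle_Limsup(2)[OF h])
  have Ds: "ereal r < model_diam \<kappa>" if "r < N" for r
    using that N(2) by (metis ereal_less_eq(3) less_ereal.simps(1) order_less_le_trans)
  have "ereal (dist x p) < model_diam \<kappa>" "ereal (dist x q) < model_diam \<kappa>"
    by (rule per_less_diamD[OF per])+
  then have pos: "sn \<kappa> (dist x p) > 0" "sn \<kappa> (dist x q) > 0" "sn \<kappa> s > 0" "sn \<kappa> (dist x q - s) > 0"
    using ne s by (auto intro!: sn_pos elim: less_model_diam_mono)
  \<comment> \<open>Otherwise \<open>p\<close> lies on \<open>T\<close>, and \<open>dist p q\<close>
    is the smallest third side that any angle allows.\<close>
  have "x' \<noteq> p"
  proof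
    assume "x' = p"
    then have "md \<kappa> (dist p q) = mdside \<kappa> (dist x p) (dist x q) 1"
      using x'q x' md_commute[of \<kappa> s "dist x q"] by (simp add: mdside_def)
    also have "\<dots> \<le> hinge_md \<kappa> x p q S T"
      unfolding hinge_md_def by (simp add: mdside_le_iff[OF pos(1,2)])
    finally show False using viol by simp
  qed
  \<comment> \<open>The divisor 3 in \<open>s\<close> keeps both hinges of the triangle
    \<open>p x x'\<close> short: their sums of sides are at most \<open>dist x p + 2 * s\<close>,
    which is \<open>s\<close> below \<open>N\<close>.\<close>
  have "3 * s = N - dist x p" by (simp add: s_def)
  have aux: "dist x p + s < N" "s + dist x' p < N" "dist x' p < N"
    using h_le s(1) \<open>3 * s = _\<close> by linarith+
  have posh: "sn \<kappa> (dist x' p) > 0" using \<open>x' \<noteq> p\<close> Ds aux by (intro sn_pos) auto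
  obtain W where W: "segment x' p W" using seg Ds aux(3) by blast
  have perI: "ereal (per z y w) < 2 * model_diam \<kappa>" if "dist z y + dist z w < N" for z y w :: 'a
    by (rule per_less_diamI[OF order_refl Ds[OF that]]) auto
  have h1: "hinge x p x' S ?T1" and h2: "hinge x' x p ?T1 W" and h3: "hinge x' p q W ?T2"
    using S T1 T2 W ne nex' \<open>x' \<noteq> p\<close> segment_reverse[OF T1] by (auto simp: hinge_def)
  have n1: "dist x p + dist x x' < N" and n2: "dist x' x + dist x' p < N"
    using aux x' by (auto simp: dist_commute)
  have "cos (hinge_angle \<kappa> x S ?T1) \<le> cosca \<kappa> x p x'"
    using nov[rule_format, OF h1 n1] hinge_md_iff(1)[OF h1 perI[OF n1]] N by (metis dist_self order_le_less_trans zero_le_dist)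
  moreover have "hinge_angle \<kappa> x S ?T1 = hinge_angle \<kappa> x S T"
    unfolding hinge_angle_def at_within_segment_initial[OF nex'(1)] ..
  ultimately have c1: "cos (hinge_angle \<kappa> x S T) \<le> cosang \<kappa> s (dist x p) (dist x' p)"
    using x'(2) by (simp add: cosang_commute[of \<kappa> s] dist_commute)
  have "dist x x' < N" using n1 by (smt (verit) zero_le_dist)
  then have "cos (hinge_angle \<kappa> x' ?T1 W) \<le> cosca \<kappa> x' x p"
    using nov[rule_format, OF h2 n2] hinge_md_iff(1)[OF h2 perI[OF n2]] by simp
  then have c2: "cos (hinge_angle \<kappa> x' ?T1 W) \<le> cosang \<kappa> s (dist x' p) (dist x p)"
    using x'(2) by (simp add: dist_commute)
  have "hinge_angle \<kappa> x' W ?T2 \<le> pi - hinge_angle \<kappa> x' ?T1 W"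
    using adjacent_angles_le_pi[OF T x'(1) nex' W] \<open>x' \<noteq> p\<close> by (simp add: hinge_angle_commute[of \<kappa> x' W])
  then have "cos (pi - hinge_angle \<kappa> x' ?T1 W) \<le> cos (hinge_angle \<kappa> x' W ?T2)"
    using hinge_angle_Limsup(2)[OF h2, of \<kappa>] hinge_angle_Limsup(2)[OF h3, of \<kappa>]
    by (subst cos_mono_le_eq) auto
  then have c3: "- cos (hinge_angle \<kappa> x' W ?T2) \<le> cosang \<kappa> s (dist x' p) (dist x p)"
    using c2 by simp
  have "sn \<kappa> (s + (dist x q - s)) > 0" using pos by simp
  note st = mdside_step[OF pos(3,4,1) posh this c1 c3]
  show ?thesis
    by (rule that[OF h3 _ x'q h_le]) (use st x'q in \<open>simp_all add: hinge_md_def\<close>)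
qed

section \<open>The descent and the limit of the violations\<close>

lemma smaller_violation:
  fixes x0 p q :: 'a
  assumes h0: "hinge x0 p q S0 T0" and per0: "ereal (per x0 p q) < 2 * model_diam \<kappa>"
    and viol0: "hinge_md \<kappa> x0 p q S0 T0 < md \<kappa> (dist p q)"
  defines "r0 \<equiv> dist x0 p + dist x0 q"
  shows "\<exists>z y w Z W. hinge z y w Z W \<and> ereal (per z y w) < 2 * model_diam \<kappa> \<and>
    dist z y + dist z w < 2 / 3 * r0 \<and> dist x0 z \<le> 3 * r0 \<and> hinge_md \<kappa> z y w Z W < md \<kappa> (dist y w)"
proof (rule ccontr)
  assume "\<not> ?thesis"
  then have nov: "md \<kappa> (dist y w) \<le> hinge_md \<kappa> z y w Z W"
    if "hinge z y w Z W" "ereal (per z y w) < 2 * model_diam \<kappa>" "dist z y + dist z w < 2 / 3 * r0"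
      "dist x0 z \<le> 3 * r0" for z y w Z W
    using that by (metis linorder_not_less)
  define \<delta> where "\<delta> = md \<kappa> (dist p q) - hinge_md \<kappa> x0 p q S0 T0"
  have \<delta>: "\<delta> > 0" using viol0 by (simp add: \<delta>_def)
  have r0: "r0 > 0" using h0 by (auto simp: r0_def hinge_def add_pos_pos)
  have "ereal (r0 / 2) < model_diam \<kappa>"
    using per0 unfolding less_twice_model_diam_iff by (rule less_model_diam_mono) (simp add: per_def r0_def)
  \<comment> \<open>There is room for \<open>N\<close> because the perimeter bound puts
    \<open>r0 / 2\<close> below the diameter; if \<open>2 / 3 * r0\<close> is too large, the
    diameter itself serves.\<close>
  then obtain N where N: "r0 / 2 < N" "N \<le> 2 / 3 * r0" "ereal N \<le> model_diam \<kappa>"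
  proof (cases "ereal (2 / 3 * r0) \<le> model_diam \<kappa>")
    case True
    then show ?thesis using r0 by (intro that[of "2 / 3 * r0"]) auto
  next
    case False
    then obtain D where "model_diam \<kappa> = ereal D" by (auto simp: model_diam_def split: if_splits)
    then show ?thesis using False \<open>ereal (r0 / 2) < _\<close> by (intro that[of D]) auto
  qed
  obtain L where L: "0 < L"
    "\<And>a b. 0 \<le> a \<Longrightarrow> a \<le> b \<Longrightarrow> b \<le> 2 * r0 \<Longrightarrow> md \<kappa> b - md \<kappa> a \<le> L * (b - a)"
    "\<And>a. 0 \<le> a \<Longrightarrow> a \<le> 2 * r0 \<Longrightarrow> sn \<kappa> a \<le> L"
    using md_lipschitz[of "2 * r0" \<kappa>] by metis
  \<comment> \<open>This contains every step length, since the shorter side lies between 0 and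
    \<open>r0 / 2\<close>. It stays away from 0, so the minimum \<open>\<eta>\<close> of
    \<open>sn\<close> on it is positive.\<close>
  let ?I = "{(N - r0 / 2) / 3..N / 3}"
  have "?I \<noteq> {}" using r0 by simp
  then obtain s0 where s0: "s0 \<in> ?I" "\<And>s. s \<in> ?I \<Longrightarrow> sn \<kappa> s0 \<le> sn \<kappa> s"
    using continuous_attains_inf[of ?I "sn \<kappa>"] continuous_on_sn by (metis compact_Icc)
  define \<eta> where "\<eta> = sn \<kappa> s0"
  have "ereal (N / 3) < model_diam \<kappa>"
    by (rule order_less_le_trans[OF _ N(3)]) (use N(1) r0 in simp)
  then have \<eta>: "\<eta> > 0"
    unfolding \<eta>_def using s0 N by (intro sn_pos) (auto elim!: less_model_diam_mono)
  \<comment> \<open>Solved from \<open>\<eta> * \<delta> \<le> L * (L * d)\<close> for the drop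
    \<open>d\<close>: one \<open>L\<close> bounds \<open>sn\<close>, the other the slope of
    \<open>md\<close>.\<close>
  define \<epsilon> where "\<epsilon> = \<eta> * \<delta> / (L * L)"
  have \<epsilon>: "\<epsilon> > 0" using \<eta> \<delta> L(1) by (simp add: \<epsilon>_def)
  \<comment> \<open>\<open>y\<close> and \<open>z\<close> are \<open>p\<close> and \<open>q\<close>,
    ordered so that the longer side comes second.\<close>
  have step: "\<exists>x' S' T'. hinge x' y z S' T' \<and> dist x' y + dist x' z \<le> dist x y + dist x z - \<epsilon> \<and>
      hinge_md \<kappa> x' y z S' T' \<le> hinge_md \<kappa> x y z S T"
    if h: "hinge x y z S T" and yz: "y = p \<and> z = q \<or> y = q \<and> z = p" and le: "dist x y \<le> dist x z"
      and r: "dist x y + dist x z \<le> r0" and m: "hinge_md \<kappa> x y z S T \<le> hinge_md \<kappa> x0 p q S0 T0"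
    for x y z S T
  proof -
    let ?r = "dist x y + dist x z"
    have dyz: "dist y z = dist p q" using yz by (auto simp: dist_commute)
    have viol: "hinge_md \<kappa> x y z S T < md \<kappa> (dist y z)" using m viol0 dyz by simp
    have "per x y z \<le> per x0 p q" using r dyz by (simp add: per_def r0_def)
    then have per: "ereal (per x y z) < 2 * model_diam \<kappa>"
      using per0 by (metis ereal_less_eq(3) order_le_less_trans)
    have "dist x0 y \<le> r0" using yz by (auto simp: r0_def)
    \<comment> \<open>Both vertices lie within \<open>r0\<close> of the fixed endpoint
      \<open>y\<close>, so the descent stays in the region where smaller violations are
      excluded.\<close>
    then have x0x: "dist x0 x \<le> 2 * r0"
      using dist_triangle[of x0 x y] r by (smt (verit) dist_commute zero_le_dist)
    \<comment> \<open>Otherwise the current hinge would itself be an excluded smaller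
      violation.\<close>
    have "\<not> ?r < 2 / 3 * r0"
      using nov[OF h per] viol x0x r0 by fastforce
    then have Nr: "N \<le> ?r" using N by linarith
    have a: "dist x y \<le> r0 / 2" using le r by linarith
    have nov': "md \<kappa> (dist y' w) \<le> hinge_md \<kappa> z' y' w Z W"
      if "hinge z' y' w Z W" "dist z' y' + dist z' w < N" "dist x z' < N" for z' y' w Z W
    proof (rule nov[OF that(1)])
      have "ereal (dist z' y' + dist z' w) < model_diam \<kappa>"
        using that(2) N(3) by (metis less_ereal.simps(1) order_less_le_trans)
      then show "ereal (per z' y' w) < 2 * model_diam \<kappa>"
        by (rule per_less_diamI[OF order_refl]) auto
      show "dist z' y' + dist z' w < 2 / 3 * r0" using that(2) N(2) by simp
      show "dist x0 z' \<le> 3 * r0" using dist_triangle[of x0 z' x] x0x that(3) N(2) r0 by linarith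
    qed
    define s where "s = (N - dist x y) / 3"
    have lt: "dist x y < N" using a N(1) by simp
    have nov'': "\<forall>z' y' w Z W. hinge z' y' w Z W \<longrightarrow> dist z' y' + dist z' w < N \<longrightarrow> dist x z' < N \<longrightarrow>
        md \<kappa> (dist y' w) \<le> hinge_md \<kappa> z' y' w Z W"
      using nov' by blast
    obtain x' S' T' where x': "hinge x' y z S' T'" "hinge_md \<kappa> x' y z S' T' \<le> hinge_md \<kappa> x y z S T"
      "dist x' z = dist x z - s" "dist x' y \<le> dist x y + s"
      "sn \<kappa> s * (md \<kappa> ?r - hinge_md \<kappa> x y z S T) \<le> sn \<kappa> (dist x z) * (md \<kappa> (dist x y + s) - md \<kappa> (dist x' y))"
      by (rule shorter_hinge[OF h per le lt N(3) Nr nov'' viol, folded s_def])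
    define d where "d = dist x y + s - dist x' y"
    have d: "d \<ge> 0" using x'(4) by (simp add: d_def)
    have sI: "s \<in> ?I" using a by (auto simp: s_def)
    \<comment> \<open>Hence the gap between the straight hinge and the current one is at least
      \<open>\<delta>\<close>. As \<open>?r\<close> may exceed the diameter, plain monotonicity of
      \<open>md\<close> would not suffice.\<close>
    have "md \<kappa> (dist y z) \<le> md \<kappa> ?r"
    proof (rule md_mono_fold)
      show "dist y z \<le> ?r" using dist_triangle[of y z x] by (simp add: dist_commute)
      have "ereal ((?r + dist y z) / 2) < model_diam \<kappa>"
        using per unfolding less_twice_model_diam_iff per_def .
      then show "ereal ((?r + dist y z) / 2) \<le> model_diam \<kappa>" by simp
    qed simp
    then have "\<delta> \<le> md \<kappa> ?r - hinge_md \<kappa> x y z S T" using m dyz by (simp add: \<delta>_def)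
    then have "\<eta> * \<delta> \<le> sn \<kappa> s * (md \<kappa> ?r - hinge_md \<kappa> x y z S T)"
      using s0(2)[OF sI] \<eta> \<delta> by (intro mult_mono) (auto simp: \<eta>_def)
    also have "\<dots> \<le> sn \<kappa> (dist x z) * (md \<kappa> (dist x y + s) - md \<kappa> (dist x' y))" by (rule x'(5))
    also have "\<dots> \<le> sn \<kappa> (dist x z) * (L * d)"
    proof (rule mult_left_mono)
      have "3 * s = N - dist x y" by (simp add: s_def)
      then have "dist x y + s \<le> 2 * r0" using a N(2) r0 zero_le_dist[of x y] by linarith
      then show "md \<kappa> (dist x y + s) - md \<kappa> (dist x' y) \<le> L * d"
        using L(2)[of "dist x' y" "dist x y + s"] x'(4) by (simp add: d_def)
      show "0 \<le> sn \<kappa> (dist x z)" using per_less_diamD(2)[OF per] by (simp add: sn_nonneg)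
    qed
    also have "\<dots> \<le> L * (L * d)"
      using L(3)[of "dist x z"] r r0 d L(1) zero_le_dist[of x y] by (intro mult_right_mono) auto
    finally have "\<epsilon> \<le> d"
      using L(1) by (simp add: \<epsilon>_def divide_le_eq mult_ac)
    then show ?thesis
      using x'(1-3) by (intro exI[of _ x'] exI[of _ S'] exI[of _ T']) (auto simp: d_def)
  qed
  have descent: "\<exists>x S T. hinge x p q S T \<and> dist x p + dist x q \<le> r0 - real k * \<epsilon> \<and>
    hinge_md \<kappa> x p q S T \<le> hinge_md \<kappa> x0 p q S0 T0" for k
  proof (induction k)
    case 0
    then show ?case using h0 by (auto simp: r0_def)
  next
    case (Suc k)
    then obtain x S T where x: "hinge x p q S T" "dist x p + dist x q \<le> r0 - real k * \<epsilon>"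
      "hinge_md \<kappa> x p q S T \<le> hinge_md \<kappa> x0 p q S0 T0" by blast
    have "real k * \<epsilon> \<ge> 0" using \<epsilon> by simp
    then have r: "dist x p + dist x q \<le> r0" using x(2) by linarith
    have "\<exists>x' S' T'. hinge x' p q S' T' \<and> dist x' p + dist x' q \<le> dist x p + dist x q - \<epsilon> \<and>
      hinge_md \<kappa> x' p q S' T' \<le> hinge_md \<kappa> x p q S T"
    proof (cases "dist x p \<le> dist x q")
      case True
      then show ?thesis using step[OF x(1) _ True r x(3)] by simp
    next
      case False
      have "hinge x q p T S" using x(1) hinge_commute by blast
      then obtain x' S' T' where "hinge x' q p S' T'" "dist x' q + dist x' p \<le> dist x q + dist x p - \<epsilon>"
        "hinge_md \<kappa> x' q p S' T' \<le> hinge_md \<kappa> x q p T S"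
        using step[of x q p T S] False r x(3) by (auto simp: hinge_md_commute[of _ x q] add.commute)
      then show ?thesis
        by (intro exI[of _ x'] exI[of _ T'] exI[of _ S'])
          (auto simp: hinge_commute[of x' p] hinge_md_commute[of _ x' p] hinge_md_commute[of _ x p])
    qed
    then obtain x' S' T' where "hinge x' p q S' T'" "dist x' p + dist x' q \<le> dist x p + dist x q - \<epsilon>"
      "hinge_md \<kappa> x' p q S' T' \<le> hinge_md \<kappa> x p q S T" by blast
    then show ?case
      using x by (intro exI[of _ x'] exI[of _ S'] exI[of _ T']) (auto simp: algebra_simps)
  qed
  \<comment> \<open>After this many steps the sum of two distances would be negative.\<close>
  obtain k where k: "r0 < real k * \<epsilon>" using reals_Archimedean3[OF \<epsilon>] by blast
  obtain x where "dist x p + dist x q \<le> r0 - real k * \<epsilon>" using descent[of k] by blast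
  then show False using k zero_le_dist[of x p] zero_le_dist[of x q] by linarith
qed

lemma hinge_md_ge:
  fixes p x y :: 'a
  assumes h: "hinge p x y S T" and per: "ereal (per p x y) < 2 * model_diam \<kappa>"
  shows "md \<kappa> (dist x y) \<le> hinge_md \<kappa> p x y S T"
proof (rule ccontr)
  assume neg: "\<not> ?thesis"
  define viol where "viol = (\<lambda>(p :: 'a, x, y, S, T). hinge p x y S T \<and>
    ereal (per p x y) < 2 * model_diam \<kappa> \<and> hinge_md \<kappa> p x y S T < md \<kappa> (dist x y))"
  define r where "r = (\<lambda>(p :: 'a, x, y, S :: 'a set, T :: 'a set). dist p x + dist p y)"
  have "\<exists>H. \<forall>n. viol (H n) \<and> (r (H (Suc n)) < 2 / 3 * r (H n) \<and> dist (fst (H n)) (fst (H (Suc n))) \<le> 3 * r (H n))"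
  proof (rule dependent_nat_choice)
    show "\<exists>H. viol H" using neg h per by (intro exI[of _ "(p, x, y, S, T)"]) (auto simp: viol_def)
    fix H and n :: nat assume "viol H"
    then obtain p x y S T where H: "H = (p, x, y, S, T)" "hinge p x y S T"
      "ereal (per p x y) < 2 * model_diam \<kappa>" "hinge_md \<kappa> p x y S T < md \<kappa> (dist x y)"
      by (cases H) (auto simp: viol_def)
    obtain z u w Z W where "hinge z u w Z W" "ereal (per z u w) < 2 * model_diam \<kappa>"
      "dist z u + dist z w < 2 / 3 * (dist p x + dist p y)" "dist p z \<le> 3 * (dist p x + dist p y)"
      "hinge_md \<kappa> z u w Z W < md \<kappa> (dist u w)"
      using smaller_violation[OF H(2-4)] by blast
    then show "\<exists>H'. viol H' \<and> (r H' < 2 / 3 * r H \<and> dist (fst H) (fst H') \<le> 3 * r H)"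
      by (intro exI[of _ "(z, u, w, Z, W)"]) (auto simp: viol_def r_def H(1))
  qed
  then obtain H where H: "\<And>n. viol (H n)" "\<And>n. r (H (Suc n)) < 2 / 3 * r (H n)"
    "\<And>n. dist (fst (H n)) (fst (H (Suc n))) \<le> 3 * r (H n)" by blast
  have r_nonneg: "0 \<le> r (H n)" for n by (simp add: r_def case_prod_beta)
  have r_le: "r (H n) \<le> (2 / 3) ^ n * r (H 0)" for n
  proof (induction n)
    case (Suc n)
    then show ?case using H(2)[of n] by simp
  qed simp
  have "(\<lambda>n. (2 / 3 :: real) ^ n * r (H 0)) \<longlonglongrightarrow> 0 * r (H 0)"
    by (intro tendsto_mult LIMSEQ_power_zero tendsto_const) auto
  then have "(\<lambda>n. (2 / 3) ^ n * r (H 0)) \<longlonglongrightarrow> 0" by simp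
  moreover have "eventually (\<lambda>n. 0 \<le> r (H n)) sequentially"
    "eventually (\<lambda>n. r (H n) \<le> (2 / 3) ^ n * r (H 0)) sequentially"
    by (rule always_eventually, rule allI, fact r_nonneg r_le)+
  ultimately have r_lim: "(\<lambda>n. r (H n)) \<longlonglongrightarrow> 0"
    by (rule tendsto_sandwich[OF _ _ tendsto_const, rotated 2])
  \<comment> \<open>The constant solves \<open>3 + 2 / 3 * 9 = 9\<close>; it is the sum of the
    geometric series with first term 3 and ratio \<open>2 / 3\<close>.\<close>
  have d: "dist (fst (H n)) (fst (H (n + j))) \<le> 9 * r (H n)" for n j
  proof (induction j arbitrary: n)
    case 0
    then show ?case using r_nonneg by simp
  next
    case (Suc j)
    then show ?case
      using dist_triangle[of "fst (H n)" "fst (H (Suc n + j))" "fst (H (Suc n))"] H(2,3)[of n] Suc[of "Suc n"]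
      by simp
  qed
  have "Cauchy (\<lambda>n. fst (H n))"
  proof (rule metric_CauchyI)
    fix e :: real assume "e > 0"
    then have "eventually (\<lambda>n. r (H n) < e / 18) sequentially"
      using order_tendstoD(2)[OF r_lim, of "e / 18"] by simp
    then obtain M where M: "r (H M) < e / 18" by (auto simp: eventually_sequentially)
    have "dist (fst (H M)) (fst (H m)) < e / 2" if "m \<ge> M" for m
      using d[of M "m - M"] that M by simp
    then show "\<exists>M. \<forall>m\<ge>M. \<forall>n\<ge>M. dist (fst (H m)) (fst (H n)) < e"
      by (meson dist_triangle_half_r)
  qed
  then obtain c where c: "(\<lambda>n. fst (H n)) \<longlonglongrightarrow> c"
    using Cauchy_convergent_iff convergent_def by blast
  obtain \<rho> where \<rho>: "\<rho> > 0"
    "\<And>p x y S T. p \<in> ball c \<rho> \<Longrightarrow> x \<in> ball c \<rho> \<Longrightarrow> y \<in> ball c \<rho> \<Longrightarrow>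
      hinge p x y S T \<Longrightarrow> distance_comparison \<kappa> p x y S T"
    using local_comparison[of c] by metis
  \<comment> \<open>One half of \<open>\<rho>\<close> is for the vertex and one for the sides, so
    that the endpoints lie in the ball as well.\<close>
  have "eventually (\<lambda>n. dist (fst (H n)) c < \<rho> / 2 \<and> r (H n) < \<rho> / 2) sequentially"
    using \<rho>(1) by (intro eventually_conj tendstoD[OF c] order_tendstoD(2)[OF r_lim]) auto
  then obtain n where n: "dist (fst (H n)) c < \<rho> / 2" "r (H n) < \<rho> / 2"
    by (auto simp: eventually_sequentially)
  obtain p x y S T where Hn: "H n = (p, x, y, S, T)" by (cases "H n")
  have v: "hinge p x y S T" "ereal (per p x y) < 2 * model_diam \<kappa>" "hinge_md \<kappa> p x y S T < md \<kappa> (dist x y)"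
    using H(1)[of n] by (auto simp: viol_def Hn)
  have "dist c p < \<rho> / 2" "dist p x + dist p y < \<rho> / 2"
    using n by (auto simp: Hn r_def dist_commute)
  then have "p \<in> ball c \<rho>" "x \<in> ball c \<rho>" "y \<in> ball c \<rho>"
    using dist_triangle[of c x p] dist_triangle[of c y p] zero_le_dist[of p x] zero_le_dist[of p y] \<rho>(1)
    unfolding mem_ball by linarith+
  then have "angle_comparison \<kappa> p x y S T"
    using \<rho>(2) v angle_comparison_if_distance_comparison by blast
  then show False using hinge_md_iff(2)[OF v(1,2)] v(3) by simp
qed

section \<open>From (H) for all hinges back to (D)\<close>

text \<open>The argument of \<open>adjacent_cosca\<close> read backwards. (H), now known for hinges
  of any size, and the bound for adjacent angles make the comparison angles at \<open>v\<close> add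
  up to at most \<pi>; Alexandrov's lemma converts this into monotonicity along
  \<open>T\<close>.\<close>

lemma cosca_le_of_point_on_side:
  fixes p x y :: 'a
  assumes h: "hinge p x y S T" and per: "ereal (per p x y) < 2 * model_diam \<kappa>"
    and v: "v \<in> T" "v \<noteq> p"
  shows "cosca \<kappa> p x v \<le> cosca \<kappa> p x y"
proof (cases "v = y")
  case False
  have S: "segment p x S" and T: "segment p y T" and ne: "p \<noteq> x" "p \<noteq> y"
    using h by (auto simp: hinge_def)
  have bt: "dist p v + dist v y = dist p y" by (rule segment_between[OF T v(1)])
  note D = per_less_diamD[OF per]
  have pvD: "ereal (dist p v) < model_diam \<kappa>"
    by (rule less_model_diam_mono[OF D(2) segment_dist_le[OF T v(1)]])
  show ?thesis
  proof (cases "v = x")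
    \<comment> \<open>Here \<open>x\<close> lies on \<open>T\<close>; both comparison triangles are
      degenerate with angle 0 at \<open>p\<close>.\<close>
    case True
    have "dist x y = dist p y - dist p x" using bt True by simp
    moreover have "sn \<kappa> (dist p x) > 0" using ne D by (simp add: sn_pos)
    ultimately show ?thesis using True md_commute[of \<kappa> "dist p y" "dist p x"] by (simp add: cosang_def)
  next
    case False
    have vx: "2 * dist v x \<le> per p x y"
      using dist_triangle[of v x p] dist_triangle[of v x y] bt by (simp add: per_def dist_commute)
    then have vxD: "ereal (dist v x) < model_diam \<kappa>"
      using per unfolding less_twice_model_diam_iff by (auto elim: less_model_diam_mono)
    then obtain W where W: "segment v x W" using seg by blast
    let ?T1 = "{w \<in> T. dist p w \<le> dist p v}" and ?T2 = "{w \<in> T. dist p v \<le> dist p w}"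
    have h1: "hinge v p x ?T1 W" and h2: "hinge v y x ?T2 W"
      using segment_reverse[OF segment_initial[OF T v(1)]] segment_final[OF T v(1)] W v False \<open>v \<noteq> y\<close>
      by (auto simp: hinge_def)
    have "per v p x \<le> per p x y" "per v y x \<le> per p x y"
      using bt dist_triangle[of v x y] dist_triangle[of v x p] by (auto simp: per_def dist_commute)
    then have p1: "ereal (per v p x) < 2 * model_diam \<kappa>" and p2: "ereal (per v y x) < 2 * model_diam \<kappa>"
      using per by (metis ereal_less_eq(3) order_le_less_trans)+
    have "hinge_angle \<kappa> v ?T2 W \<le> pi - hinge_angle \<kappa> v ?T1 W"
      using adjacent_angles_le_pi[OF T v(1,2) \<open>v \<noteq> y\<close> W] False by simp
    then have "cos (pi - hinge_angle \<kappa> v ?T1 W) \<le> cos (hinge_angle \<kappa> v ?T2 W)"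
      using hinge_angle_Limsup(2)[OF h1, of \<kappa>] hinge_angle_Limsup(2)[OF h2, of \<kappa>]
      by (subst cos_mono_le_eq) auto
    moreover have "cos (hinge_angle \<kappa> v ?T1 W) \<le> cosca \<kappa> v p x"
      using hinge_md_ge[OF h1 p1] hinge_md_iff(1)[OF h1 p1] by simp
    moreover have "cos (hinge_angle \<kappa> v ?T2 W) \<le> cosca \<kappa> v y x"
      using hinge_md_ge[OF h2 p2] hinge_md_iff(1)[OF h2 p2] by simp
    ultimately have "0 \<le> cosca \<kappa> v p x + cosca \<kappa> v y x" by simp
    then have "mdside \<kappa> (dist p v) (dist p x) (cosca \<kappa> p y x) \<le> md \<kappa> (dist v x)"
      using cosang_sum_nonneg_iff[of "dist v p" "dist v y" "dist v x" "dist p x" \<kappa> "dist y x"]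
        D vxD bt ne v False \<open>v \<noteq> y\<close> by (simp add: dist_commute)
    then have "cosca \<kappa> p v x \<le> cosca \<kappa> p y x"
      using D(1) pvD ne v
      by (subst (asm) mdside_le_md_iff) (auto intro!: sn_pos)
    then show ?thesis by (simp add: cosca_commute[of \<kappa> p x])
  qed
qed simp

end

theorem theorem2p3:
  fixes \<kappa> :: real
  assumes curv: "alexandrov_curvature_ge TYPE('a::complete_space) \<kappa>"
    and seg: "\<And>a b :: 'a. ereal (dist a b) < model_diam \<kappa> \<Longrightarrow> \<exists>S. segment a b S"
  shows "\<forall>(p :: 'a) x y S T. hinge p x y S T \<and> ereal (per p x y) < 2 * model_diam \<kappa> \<longrightarrow>
           angle_comparison \<kappa> p x y S T \<and>
           hinge_comparison \<kappa> p x y S T \<and>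
           distance_comparison \<kappa> p x y S T"
proof (intro allI impI; elim conjE)
  fix p x y :: 'a and S T
  assume h: "hinge p x y S T" and per: "ereal (per p x y) < 2 * model_diam \<kappa>"
  have md: "md \<kappa> (dist x y) \<le> hinge_md \<kappa> p x y S T"
    by (rule hinge_md_ge[OF curv seg h per])
  have S: "segment p x S" and T: "segment p y T" and ne: "p \<noteq> x" "p \<noteq> y"
    using h by (auto simp: hinge_def)
  have "cosca \<kappa> p u v \<le> cosca \<kappa> p x y"
    if u: "u \<in> S" "u \<noteq> p" and v: "v \<in> T" "v \<noteq> p" for u v
  proof -
    \<comment> \<open>First \<open>y\<close> is moved to \<open>v\<close> along \<open>T\<close>;
      then, in this hinge with the sides exchanged, \<open>x\<close> is moved to \<open>u\<close>
      along \<open>S\<close>.\<close>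
    have h': "hinge p v x {w \<in> T. dist p w \<le> dist p v} S"
      using v segment_initial[OF T v(1)] S ne by (auto simp: hinge_def)
    have per': "ereal (per p v x) < 2 * model_diam \<kappa>"
      using per_subhinge_less[OF h segment_ends(2)[OF S] v(1) per] by (simp add: per_commute)
    have "cosca \<kappa> p v u \<le> cosca \<kappa> p v x"
      by (rule cosca_le_of_point_on_side[OF curv seg h' per' u])
    also have "\<dots> \<le> cosca \<kappa> p x y"
      using cosca_le_of_point_on_side[OF curv seg h per v] by (simp add: cosca_commute)
    finally show ?thesis by (simp add: cosca_commute)
  qed
  then have "distance_comparison \<kappa> p x y S T"
    by (intro distance_comparisonI[OF h per])
  then show "angle_comparison \<kappa> p x y S T \<and> hinge_comparison \<kappa> p x y S T \<and> distance_comparison \<kappa> p x y S T"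
    using md hinge_md_iff(2)[OF h per] hinge_comparisonI[OF h per] by blast
qed

end
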